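(* Let $n\geq 2$ be an integer and let $a,b\in\mathbb{N}$. Define the two partitions $\alpha=(a+b,a^{n-2})$ and $\beta=(a+b,b^{n-2})$. Fix any partition $\mu\in\operatorname{Par}[n]$, regarded as an $n$-tuple $(\mu_1,\mu_2,\ldots,\mu_n)$. Define a map $\varphi:\mathbb{Z}^n\to\mathbb{Z}^n$ as follows. Let $\omega=(\omega_1,\ldots,\omega_n)\in\mathbb{Z}^n$. Define $\nu=(\nu_1,\ldots,\nu_n)\in\mathbb{Z}^n$ by $\nu_i=\omega_i-a$ for each $i\in\{1,2,\ldots,n\}$. For each $i\in\mathbb{Z}$, let $i\#$ denote the unique element of $\{1,2,\ldots,n\}$ congruent to $i$ modulo $n$. For each $j\in\mathbb{Z}$, set $$\tau_j=\min\left\{\left(\nu_{(j+1)\#}+\nu_{(j+2)\#}+\cdots+\nu_{(j+k)\#}\right)+\left(\mu_{(j+k+1)\#}+\mu_{(j+k+2)\#}+\cdots+\mu_{(j+n-1)\#}\right)\ \mid\ k\in\{0,1,\ldots,n-1\}\right\}.$$ Define $\eta=(\eta_1,\ldots,\eta_n)\in\mathbb{Z}^n$ by $$\eta_i=\mu_{i\#}+\left(\mu_{(i-1)\#}+\tau_{(i-1)\#}\right)-\left(\nu_{(i+1)\#}+\tau_{(i+1)\#}\right)\quad\text{for each } i\in\{1,2,\ldots,n\}.$$ Let $\varphi(\omega)=(\eta_1+b,\eta_2+b,\ldots,\eta_n+b)$. Then: (a) The map $\varphi$ is a bijection. (b) We have $c_{\alpha,\mu}^{\omega}=c_{\beta,\mu}^{\varphi(\omega)}$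 for each $\omega\in\mathbb{Z}^n$. Here, every $n$-tuple $\omega\in\mathbb{Z}^n$ that is not a partition satisfies $c_{\alpha,\mu}^{\omega}=0$ and $c_{\beta,\mu}^{\omega}=0$ by convention.
   Context: $\mathbb{N}=\{0,1,2,\ldots\}$. A partition is a weakly decreasing infinite sequence of nonnegative integers with only finitely many nonzero entries; trailing zeroes may be omitted, so an $n$-tuple $(\lambda_1,\ldots,\lambda_n)\in\mathbb{Z}^n$ is a partition if and only if $\lambda_1\geq\cdots\geq\lambda_n\geq 0$. $\operatorname{Par}$ is the set of all partitions and $\operatorname{Par}[n]$ is the set of partitions with at most $n$ nonzero entries, identified with $n$-tuples in $\mathbb{Z}^n$. In a tuple, $m^k$ stands for $m,m,\ldots,m$ ($k$ times). For partitions $\lambda,\mu,\nu$, the Littlewood--Richardson coefficient $c_{\mu,\nu}^{\lambda}$ is the integer defined by $s_\mu s_\nu=\sum_{\lambda\in\operatorname{Par}}c_{\mu,\nu}^{\lambda}s_\lambda$, where $s_\lambda$ are the Schur functions in infinitely many variables. Empty sums are $0$. *)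

theory Defs
  imports Main "HOL-Library.FuncSet" "HOL-Library.Poly_Mapping" "HOL-Number_Theory.Cong"
begin

text \<open>Sequences are indexed from 0, so a partition \<open>l\<close> has \<open>l i\<close> as its \<open>(i+1)\<close>-st entry.
  Entries are integers so that tuples in \<open>\<int>\<^sup>n\<close> and partitions share one type of entries.\<close>

definition Par :: "(nat \<Rightarrow> int) set" where
  "Par = {l. antimono l \<and> (\<forall>i. 0 \<le> l i) \<and> finite {i. l i \<noteq> 0}}"

definition Par_upto :: "nat \<Rightarrow> (nat \<Rightarrow> int) set" where
  "Par_upto n = {l \<in> Par. card {i. l i \<noteq> 0} \<le> n}"

definition tuples :: "nat \<Rightarrow> int list set" where
  "tuples n = {w. length w = n}"

definition entry :: "int list \<Rightarrow> int \<Rightarrow> int" where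
  "entry w i = w ! nat (i - 1)"

definition pad :: "int list \<Rightarrow> nat \<Rightarrow> int" where
  "pad w = (\<lambda>i. if i < length w then w ! i else 0)"

definition truncate :: "nat \<Rightarrow> (nat \<Rightarrow> int) \<Rightarrow> int list" where
  "truncate n l = map l [0..<n]"

text \<open>Formal power series over \<open>\<int>\<close> in countably many variables \<open>x\<^sub>0, x\<^sub>1, \<dots>\<close> are given by
  their coefficient functions; a monomial is a finitely supported exponent vector.\<close>

type_synonym monom = "nat \<Rightarrow>\<^sub>0 nat"
type_synonym mseries = "monom \<Rightarrow> int"

definition mtimes :: "mseries \<Rightarrow> mseries \<Rightarrow> mseries" where
  "mtimes f g = (\<lambda>m. \<Sum>(p, q) \<in> {(p, q). p + q = m}. f p * g q)"

definition diagram :: "(nat \<Rightarrow> int) \<Rightarrow> (nat \<times> nat) set" where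
  "diagram l = {(i, j). int j < l i}"

definition ssyt :: "(nat \<Rightarrow> int) \<Rightarrow> (nat \<times> nat \<Rightarrow> nat) set" where
  "ssyt l = {T \<in> extensional (diagram l).
     (\<forall>i j j'. (i, j) \<in> diagram l \<and> (i, j') \<in> diagram l \<and> j < j' \<longrightarrow> T (i, j) \<le> T (i, j')) \<and>
     (\<forall>i i' j. (i, j) \<in> diagram l \<and> (i', j) \<in> diagram l \<and> i < i' \<longrightarrow> T (i, j) < T (i', j))}"

text \<open>The Schur function is the sum of \<open>\<Prod>c \<in> diagram l. x\<^bsub>T c\<^esub>\<close> over all semistandard
  tableaux \<open>T\<close> of shape \<open>l\<close>, so its coefficient at a monomial counts the tableaux with that content.\<close>

definition schur :: "(nat \<Rightarrow> int) \<Rightarrow> mseries" where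
  "schur l = (\<lambda>m. int (card {T \<in> ssyt l.
     \<forall>k. card {c \<in> diagram l. T c = k} = Poly_Mapping.lookup m k}))"

text \<open>Only finitely many terms contribute to each coefficient of a product and of a Schur function.\<close>

lemma finite_decompositions: "finite {(p :: monom, q). p + q = m}"
proof -
  let ?l = "Poly_Mapping.lookup"
  define K where "K = Poly_Mapping.keys m"
  define N where "N = (\<Sum>x\<in>K. ?l m x)"
  have fK: "finite K" by (simp add: K_def)
  have "{p :: monom. \<exists>q. p + q = m}
      \<subseteq> ?l -` {f. \<forall>x. (x \<in> K \<longrightarrow> f x \<in> {..N}) \<and> (x \<notin> K \<longrightarrow> f x = 0)}"
  proof
    fix p :: monom
    assume "p \<in> {p. \<exists>q. p + q = m}"
    then obtain q where m: "m = p + q" by auto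
    have "?l p x \<le> N" if "x \<in> K" for x
    proof -
      have "?l m x \<le> N" unfolding N_def using fK that by (intro member_le_sum) auto
      then show ?thesis by (simp add: m lookup_add)
    qed
    moreover have "?l p x = 0" if "x \<notin> K" for x
    proof -
      have "?l m x = 0" using that by (simp add: K_def in_keys_iff)
      then show ?thesis by (simp add: m lookup_add)
    qed
    ultimately show "p \<in> ?l -` {f. \<forall>x. (x \<in> K \<longrightarrow> f x \<in> {..N}) \<and> (x \<notin> K \<longrightarrow> f x = 0)}"
      by simp
  qed
  moreover have "finite (?l -` {f. \<forall>x. (x \<in> K \<longrightarrow> f x \<in> {..N}) \<and> (x \<notin> K \<longrightarrow> f x = 0)})"
    by (intro finite_vimageI finite_set_of_finite_funs fK finite_atMost)
       (rule injI, simp)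
  ultimately have "finite {p :: monom. \<exists>q. p + q = m}"
    by (rule finite_subset)
  moreover have "{(p :: monom, q). p + q = m} \<subseteq> (\<lambda>p. (p, m - p)) ` {p. \<exists>q. p + q = m}"
    by force
  ultimately show ?thesis by (meson finite_imageI finite_subset)
qed

lemma finite_diagram: assumes "l \<in> Par" shows "finite (diagram l)"
proof -
  have "diagram l \<subseteq> (SIGMA i : {i. l i \<noteq> 0}. {..<nat (l i)})"
    by (auto simp: diagram_def)
  moreover have "finite (SIGMA i : {i. l i \<noteq> 0}. {..<nat (l i)})"
    using assms by (auto simp: Par_def)
  ultimately show ?thesis by (rule finite_subset)
qed

lemma finite_ssyt_content:
  assumes "l \<in> Par"
  shows "finite {T \<in> ssyt l. \<forall>k. card {c \<in> diagram l. T c = k} = Poly_Mapping.lookup m k}"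
proof (rule finite_subset)
  show "finite (diagram l \<rightarrow>\<^sub>E Poly_Mapping.keys m)"
    by (intro finite_PiE finite_diagram assms) auto
  show "{T \<in> ssyt l. \<forall>k. card {c \<in> diagram l. T c = k} = Poly_Mapping.lookup m k}
      \<subseteq> diagram l \<rightarrow>\<^sub>E Poly_Mapping.keys m"
  proof
    fix T
    assume "T \<in> {T \<in> ssyt l. \<forall>k. card {c \<in> diagram l. T c = k} = Poly_Mapping.lookup m k}"
    then have ext: "T \<in> extensional (diagram l)"
      and T: "\<And>k. card {c \<in> diagram l. T c = k} = Poly_Mapping.lookup m k"
      by (auto simp: ssyt_def)
    have "T d \<in> Poly_Mapping.keys m" if d: "d \<in> diagram l" for d
    proof -
      have "finite {c \<in> diagram l. T c = T d}"
        using finite_diagram[OF assms] by simp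
      moreover have "{c \<in> diagram l. T c = T d} \<noteq> {}" using d by blast
      ultimately have "card {c \<in> diagram l. T c = T d} \<noteq> 0"
        by (simp only: card_0_eq not_False_eq_True)
      then show ?thesis by (simp only: T in_keys_iff not_False_eq_True)
    qed
    with ext show "T \<in> diagram l \<rightarrow>\<^sub>E Poly_Mapping.keys m"
      by (simp add: PiE_iff)
  qed
qed

text \<open>The coefficients \<open>c\<^bsub>mu,nu\<^esub>\<^bsup>l\<^esup>\<close> of the expansion of \<open>s\<^bsub>mu\<^esub> s\<^bsub>nu\<^esub>\<close> in the basis
  of Schur functions of the ring of symmetric functions: the unique finitely supported family
  indexed by partitions (extended by 0 to all sequences).\<close>

definition lr :: "(nat \<Rightarrow> int) \<Rightarrow> (nat \<Rightarrow> int) \<Rightarrow> (nat \<Rightarrow> int) \<Rightarrow> int" where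
  "lr mu nu = (THE c. finite {l. c l \<noteq> 0} \<and> {l. c l \<noteq> 0} \<subseteq> Par \<and>
     mtimes (schur mu) (schur nu) = (\<lambda>m. \<Sum>l \<in> {l. c l \<noteq> 0}. c l * schur l m))"

definition lr_coeff :: "(nat \<Rightarrow> int) \<Rightarrow> (nat \<Rightarrow> int) \<Rightarrow> int list \<Rightarrow> int" where
  "lr_coeff mu nu w = (if pad w \<in> Par then lr mu nu (pad w) else 0)"

text \<open>\<open>hash n i\<close> is \<open>i#\<close>.\<close>

definition hash :: "nat \<Rightarrow> int \<Rightarrow> int" where
  "hash n i = (THE r. r \<in> {1..int n} \<and> [r = i] (mod int n))"

lemma hash_eq:
  assumes "n > 0"
  shows "hash n i = (i - 1) mod int n + 1"
  unfolding hash_def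
proof (rule the_equality)
  have "[(i - 1) mod int n + 1 = i] (mod int n)"
    by (simp add: cong_def mod_simps)
  moreover have "(i - 1) mod int n + 1 \<in> {1..int n}"
    using assms pos_mod_bound[of "int n" "i - 1"] pos_mod_sign[of "int n" "i - 1"]
    by (simp only: atLeastAtMost_iff) linarith
  ultimately show *: "(i - 1) mod int n + 1 \<in> {1..int n} \<and> [(i - 1) mod int n + 1 = i] (mod int n)"
    by blast
  fix r assume r: "r \<in> {1..int n} \<and> [r = i] (mod int n)"
  then have "[r - 1 = i - 1] (mod int n)" by (simp add: cong_diff)
  then have "(r - 1) mod int n = (i - 1) mod int n" by (simp add: cong_def)
  moreover have "(r - 1) mod int n = r - 1" using r by (auto intro: mod_pos_pos_trivial)
  ultimately show "r = (i - 1) mod int n + 1" by simp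
qed

definition tau :: "nat \<Rightarrow> int list \<Rightarrow> int list \<Rightarrow> int \<Rightarrow> int" where
  "tau n mu nu j = Min ((\<lambda>k. (\<Sum>i = 1..k. entry nu (hash n (j + i)))
       + (\<Sum>i = k + 1..int n - 1. entry mu (hash n (j + i)))) ` {0..int n - 1})"

definition eta :: "nat \<Rightarrow> int list \<Rightarrow> int list \<Rightarrow> int \<Rightarrow> int" where
  "eta n mu nu i = entry mu (hash n i)
     + (entry mu (hash n (i - 1)) + tau n mu nu (hash n (i - 1)))
     - (entry nu (hash n (i + 1)) + tau n mu nu (hash n (i + 1)))"

definition phi :: "nat \<Rightarrow> nat \<Rightarrow> nat \<Rightarrow> int list \<Rightarrow> int list \<Rightarrow> int list" where
  "phi n a b mu w = (let nu = map (\<lambda>x. x - int a) w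
     in map (\<lambda>i. eta n mu nu i + int b) [1..int n])"

end

theory Submission
  imports Defs
begin

text \<open>In \<open>n\<close> variables \<open>s\<^sub>\<alpha>\<close> is \<open>(x\<^sub>1 \<dots> x\<^sub>n)\<^sup>a\<close> times
  \<open>h\<^sub>b(x) h\<^sub>a(x\<^sup>-\<^sup>1) - h\<^bsub>b-1\<^esub>(x) h\<^bsub>a-1\<^esub>(x\<^sup>-\<^sup>1)\<close>. By the Pieri rules for adding and removing horizontal
  strips, the coefficient of \<open>s\<^sub>\<omega>\<close> in \<open>s\<^sub>\<alpha> s\<^sub>\<mu>\<close> is therefore the number of integer points
  \<open>\<kappa>\<close> with prescribed sum in the product of the intervals
  \<open>[max(\<mu>\<^bsub>i+1\<^esub>, \<nu>\<^bsub>i+1\<^esub>), min(\<mu>\<^sub>i, \<nu>\<^sub>i)]\<close>, where \<open>\<nu> = \<omega> - a\<close>. The map \<open>\<nu> \<mapsto> \<eta>\<close> is a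
  piecewise linear involution that preserves the lengths of these intervals and shifts them in such a
  way that the roles of \<open>a\<close> and \<open>b\<close> are exchanged. It is the min-plus form of the birational
  involution \<open>y\<^sub>i = u\<^sub>i u\<^bsub>i-1\<^esub> t\<^bsub>i-1\<^esub> / (x\<^bsub>i+1\<^esub> t\<^bsub>i+1\<^esub>)\<close>, and all its properties come from
  \<open>x\<^bsub>i+1\<^esub> t\<^bsub>i+1\<^esub> + u\<^bsub>i-1\<^esub> t\<^bsub>i-1\<^esub> = (u\<^sub>i + x\<^sub>i) t\<^sub>i\<close>.\<close>

section \<open>A cyclic min-plus involution\<close>

text \<open>Removing a horizontal strip can leave the realm of partitions: rows acquire negative
  entries, for which there are no tableaux. Pattern counts accept arbitrary integer rows, so both
  Pieri rules are proved for them, and tableaux serve only to identify Schur coefficients with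
  pattern counts. Working in \<open>n\<close> variables loses nothing: shapes with more than
  \<open>n\<close> rows vanish there and the others stay linearly independent. As \<open>lr\<close>
  is a definite description, existence and uniqueness of Schur expansions of products are part of
  the proof. The birational identities behind the involution use subtraction, which min-plus algebra
  lacks. Hence the sums \<open>U\<close> of \<mu> and \<open>X\<close> of \<nu> are compared, and
  the case \<open>U = X\<close> needs a cycle-lemma argument. The exchange of a and b comes from
  sums: a point \<kappa> has |\<kappa>| = |\<mu>| + b = |\<nu>| + a. Moving it with its box adds
  |\<mu>| - |\<nu>|, and |\<eta>| = 2|\<mu>| - |\<nu>|, so the moved point satisfies the two
  equations for \<eta> with a and b exchanged.\<close>

lemma periodic_sum:
  fixes f :: "int \<Rightarrow> int"
  assumes per: "\<And>i. f (i + int n) = f i"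
  shows "(\<Sum>j<n. f (i + int j)) = (\<Sum>j<n. f (int j))"
proof -
  have step: "(\<Sum>j<n. f (i + 1 + int j)) = (\<Sum>j<n. f (i + int j))" for i
  proof -
    have "(\<Sum>j<n. f (i + 1 + int j)) + f i = (\<Sum>j<Suc n. f (i + int j))"
      by (simp add: sum.lessThan_Suc_shift algebra_simps del: sum.lessThan_Suc)
    then show ?thesis by (simp add: per)
  qed
  show ?thesis
  proof (induction i rule: int_induct[where k = 0])
    case (step2 i)
    then show ?case using step[of "i - 1"] by simp
  qed (auto simp: step)
qed

text \<open>Residues modulo \<open>n\<close> are absorbed into periodic functions on the integers,
  with \<open>u\<close> standing for \<mu> and \<open>x\<close> for \<nu>.\<close>

definition cyc_tau :: "nat \<Rightarrow> (int \<Rightarrow> int) \<Rightarrow> (int \<Rightarrow> int) \<Rightarrow> int \<Rightarrow> int" where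
  "cyc_tau n u x j = Min ((\<lambda>k. (\<Sum>i<k. x (j + 1 + int i)) + (\<Sum>i\<in>{k..<n-1}. u (j + 1 + int i))) ` {..<n})"

definition cyc_eta :: "nat \<Rightarrow> (int \<Rightarrow> int) \<Rightarrow> (int \<Rightarrow> int) \<Rightarrow> int \<Rightarrow> int" where
  "cyc_eta n u x i = u i + (u (i - 1) + cyc_tau n u x (i - 1)) - (x (i + 1) + cyc_tau n u x (i + 1))"

text \<open>Min-plus form of the telescoping identity
  \<open>\<Sum>k<n. V\<^sub>0 \<dots> V\<^bsub>k-1\<^esub> (V\<^sub>k - W\<^sub>k) W\<^bsub>k+1\<^esub> \<dots> W\<^bsub>n-1\<^esub> = \<Prod>V - \<Prod>W\<close>
  in the case where all differences \<open>V\<^sub>k - W\<^sub>k\<close> equal \<open>U - X\<close>.\<close>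

lemma telescoping_min:
  fixes V W M :: "nat \<Rightarrow> int"
  assumes V: "\<And>k. k < n \<Longrightarrow> V k = min U (M k)" and W: "\<And>k. k < n \<Longrightarrow> W k = min X (M k)"
    and sum: "(\<Sum>k<n. V k - W k) = U - X" and eq: "U = X \<Longrightarrow> \<exists>k<n. U \<le> M k"
  shows "\<forall>k<n. - X \<le> (\<Sum>j<k. V j - W j) - W k" "\<exists>k<n. (\<Sum>j<k. V j - W j) - W k = - X"
proof -
  define d where "d j = V j - W j" for j
  have split: "(\<Sum>j<k. d j) = U - X - d k - (\<Sum>j\<in>{Suc k..<n}. d j)" if "k < n" for k
  proof -
    have "{..<n} = {..<k} \<union> {k} \<union> {Suc k..<n}" using that by auto
    then have "(\<Sum>j<n. d j) = (\<Sum>j\<in>{..<k} \<union> {k} \<union> {Suc k..<n}. d j)" by simp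
    also have "\<dots> = (\<Sum>j<k. d j) + d k + (\<Sum>j\<in>{Suc k..<n}. d j)"
      by (subst sum.union_disjoint; force)+
    finally show ?thesis using sum by (simp add: d_def)
  qed
  \<comment> \<open>In place of a division by \<open>U - X\<close>, its sign decides whether the
    first or the last nonzero \<open>d k\<close> attains the bound.\<close>
  consider "X < U" | "U < X" | "U = X" by linarith
  then have "(\<forall>k<n. - X \<le> (\<Sum>j<k. d j) - W k) \<and> (\<exists>k<n. (\<Sum>j<k. d j) - W k = - X)"
  proof cases
    case 1
    have d: "0 \<le> d k" if "k < n" for k using V[OF that] W[OF that] 1 by (simp add: d_def)
    have "0 \<le> (\<Sum>j<k. d j)" if "k < n" for k using d that by (intro sum_nonneg) auto
    then have "\<forall>k<n. - X \<le> (\<Sum>j<k. d j) - W k" using W by force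
    moreover have "\<exists>k<n. d k \<noteq> 0"
    proof (rule ccontr)
      assume "\<not> ?thesis"
      then have "(\<Sum>j<n. d j) = 0" by (intro sum.neutral) auto
      then show False using sum 1 by (simp add: d_def)
    qed
    then have "\<exists>k. (k < n \<and> d k \<noteq> 0) \<and> (\<forall>j<k. \<not> (j < n \<and> d j \<noteq> 0))"
      by (subst (asm) exists_least_iff)
    \<comment> \<open>A nonzero difference means that \<open>M k\<close> exceeds \<open>X\<close>,
      so \<open>W k = X\<close>; before the first such \<open>k\<close> the partial sum is
      0.\<close>
    then obtain k where k: "k < n" "d k \<noteq> 0" "\<And>j. j < k \<Longrightarrow> d j = 0"
      by (meson order_less_trans)
    then have "(\<Sum>j<k. d j) - W k = - X" using V[of k] W[of k] 1 by (simp add: d_def)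
    ultimately show ?thesis using k(1) by blast
  next
    case 2
    have d: "d k \<le> 0" if "k < n" for k using V[OF that] W[OF that] 2 by (simp add: d_def)
    have "- X \<le> (\<Sum>j<k. d j) - W k" if "k < n" for k
    proof -
      have "(\<Sum>j\<in>{Suc k..<n}. d j) \<le> 0" using d by (intro sum_nonpos) auto
      then show ?thesis using split[OF that] V[OF that] by (simp add: d_def)
    qed
    \<comment> \<open>By \<open>split\<close> the expression equals \<open>U - X - V k\<close> minus
      a tail sum, so the last nonzero difference is the witness: there \<open>V k = U\<close> and
      the tail vanishes.\<close>
    moreover define k where "k = Max {k. k < n \<and> d k \<noteq> 0}"
    have "{k. k < n \<and> d k \<noteq> 0} \<noteq> {}"
    proof
      assume "{k. k < n \<and> d k \<noteq> 0} = {}"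
      then have "(\<Sum>j<n. d j) = 0" by (intro sum.neutral) auto
      then show False using sum 2 by (simp add: d_def)
    qed
    then have "k \<in> {k. k < n \<and> d k \<noteq> 0}" unfolding k_def by (intro Max_in) auto
    moreover have "d j = 0" if "k < j" "j < n" for j
    proof (rule ccontr)
      assume "d j \<noteq> 0"
      then have "j \<le> k" unfolding k_def using that by (intro Max_ge) auto
      then show False using that by simp
    qed
    then have "(\<Sum>j\<in>{Suc k..<n}. d j) = 0" by (intro sum.neutral) auto
    ultimately have "k < n" "(\<Sum>j<k. d j) - W k = - X"
      using split[of k] V[of k] W[of k] 2 by (auto simp: d_def)
    with \<open>\<And>k. k < n \<Longrightarrow> - X \<le> (\<Sum>j<k. d j) - W k\<close> show ?thesis by blast
  next
    case 3
    have d: "d k = 0" if "k < n" for k using V[OF that] W[OF that] 3 by (simp add: d_def)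
    then have s: "(\<Sum>j<k. d j) = 0" if "k < n" for k using that by (intro sum.neutral) auto
    then show ?thesis using eq[OF 3] W 3 by force
  qed
  then show "\<forall>k<n. - X \<le> (\<Sum>j<k. V j - W j) - W k" "\<exists>k<n. (\<Sum>j<k. V j - W j) - W k = - X"
    by (simp_all add: d_def)
qed

locale cyclic_pair =
  fixes n :: nat and u x :: "int \<Rightarrow> int"
  assumes n: "2 \<le> n" and u_per: "u (i + int n) = u i" and x_per: "x (i + int n) = x i"
begin

abbreviation t where "t \<equiv> cyc_tau n u x"
abbreviation y where "y \<equiv> cyc_eta n u x"
abbreviation U where "U \<equiv> (\<Sum>j<n. u (int j))"
abbreviation X where "X \<equiv> (\<Sum>j<n. x (int j))"

definition mixed where "mixed i k = (\<Sum>j<k. x (i + 1 + int j)) + (\<Sum>j\<in>{k..<n}. u (i + 1 + int j))" for i k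

text \<open>\<open>mixed i k\<close> leads from \<open>U\<close> at \<open>k = 0\<close> to
  \<open>X\<close> at \<open>k = n\<close>. The interior minimum is shared by
  \<open>u i + t i\<close> and \<open>x (i + 1) + t (i + 1)\<close>, which differ only in the
  endpoint they include.\<close>

definition M where "M i = Min (mixed i ` {1..<n})" for i

lemma t_per: "t (i + int n) = t i"
proof -
  have "u (i + int n + 1 + int j) = u (i + 1 + int j)" "x (i + int n + 1 + int j) = x (i + 1 + int j)" for j
    using u_per[of "i + 1 + int j"] x_per[of "i + 1 + int j"] by (simp_all add: algebra_simps)
  then show ?thesis by (simp add: cyc_tau_def)
qed

lemma y_per: "y (i + int n) = y i"
proof -
  have *: "i + int n + 1 = i + 1 + int n" "i + int n - 1 = i - 1 + int n" by simp_all
  show ?thesis unfolding cyc_eta_def * u_per x_per t_per ..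
qed

lemma mixed_0: "mixed i 0 = U"
  using periodic_sum[where f = u and n = n and i = "i + 1", OF u_per] by (simp add: mixed_def lessThan_atLeast0)

lemma mixed_n: "mixed i n = X"
  using periodic_sum[where f = x and n = n and i = "i + 1", OF x_per] by (simp add: mixed_def)

text \<open>Adding \<open>u i\<close> completes the window of length \<open>n - 1\<close> to a full
  period, because \<open>u\<close> agrees at \<open>i\<close> and \<open>i + n\<close>.\<close>

lemma u_plus_t: "u i + t i = min U (M i)"
proof -
  have "u i + t i = Min ((\<lambda>k. (\<Sum>j<k. x (i + 1 + int j)) + (\<Sum>j\<in>{k..<n-1}. u (i + 1 + int j)) + u i) ` {..<n})"
    using n by (subst Min_add_commute) (auto simp: cyc_tau_def lessThan_empty_iff)
  also have "\<dots> = Min (mixed i ` {..<n})"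
  proof (intro arg_cong[where f = Min] image_cong refl)
    fix k assume "k \<in> {..<n}"
    then have "{k..<n} = insert (n - 1) {k..<n-1}" by auto
    moreover have "u (i + 1 + int (n - 1)) = u i" using u_per[of i] n by (simp add: of_nat_diff)
    ultimately show "(\<Sum>j<k. x (i + 1 + int j)) + (\<Sum>j\<in>{k..<n-1}. u (i + 1 + int j)) + u i = mixed i k"
      by (simp add: mixed_def)
  qed
  also have "{..<n} = insert 0 {1..<n}" using n by auto
  finally show ?thesis using n by (simp add: mixed_0 M_def)
qed

text \<open>Prepending \<open>x (i + 1)\<close> raises the number of leading \<open>x\<close> terms
  by one, so \<open>k\<close> runs from 1 to \<open>n\<close> and the endpoint is \<open>X\<close>
  instead of \<open>U\<close>.\<close>

lemma x_plus_t: "x (i + 1) + t (i + 1) = min X (M i)"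
proof -
  have "x (i + 1) + t (i + 1) = Min ((\<lambda>k. (\<Sum>j<k. x (i + 2 + int j)) + (\<Sum>j\<in>{k..<n-1}. u (i + 2 + int j)) + x (i + 1)) ` {..<n})"
    using n by (subst Min_add_commute) (auto simp: cyc_tau_def lessThan_empty_iff add.assoc)
  also have "\<dots> = Min ((mixed i \<circ> Suc) ` {..<n})"
  proof (intro arg_cong[where f = Min] image_cong refl)
    fix k assume "k \<in> {..<n}"
    have "(\<Sum>j\<in>{k..<n-1}. u (i + 2 + int j)) = (\<Sum>j\<in>{Suc k..<Suc (n-1)}. u (i + 1 + int j))"
      by (subst sum.shift_bounds_Suc_ivl) (simp add: algebra_simps)
    then show "(\<Sum>j<k. x (i + 2 + int j)) + (\<Sum>j\<in>{k..<n-1}. u (i + 2 + int j)) + x (i + 1) = (mixed i \<circ> Suc) k"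
      using n by (simp add: mixed_def sum.lessThan_Suc_shift algebra_simps del: sum.lessThan_Suc)
  qed
  also have "(mixed i \<circ> Suc) ` {..<n} = mixed i ` insert n {1..<n}"
  proof -
    have "Suc ` {..<n} = insert n {1..<n}" using n by (auto simp: image_Suc_lessThan)
    then show ?thesis by (simp only: image_comp[symmetric])
  qed
  finally show ?thesis using n by (simp add: mixed_n M_def)
qed

text \<open>Both sides are the minimum of \<open>U\<close>, \<open>X\<close>, \<open>M i\<close> and
  \<open>M (i - 1)\<close>, paired differently.\<close>

lemma three_term: "min (x (i + 1) + t (i + 1)) (u (i - 1) + t (i - 1)) = min (u i) (x i) + t i"
proof -
  have "min (u i) (x i) + t i = min (u i + t i) (x i + t i)" by simp
  then show ?thesis
    using u_plus_t[of i] u_plus_t[of "i - 1"] x_plus_t[of i] x_plus_t[of "i - 1"] by (simp add: ac_simps)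
qed

lemma sum_shift1: "(\<And>i. f (i + int n) = f i) \<Longrightarrow> (\<Sum>j<n. f (int j + c)) = (\<Sum>j<n. f (int j :: int) :: int)"
  using periodic_sum[of f n c] by (simp add: add.commute)

lemma sum_y: "(\<Sum>j<n. y (int j)) = 2 * U - X"
proof -
  have 1: "(\<Sum>j<n. u (int j - 1) + t (int j - 1)) = U + (\<Sum>j<n. t (int j))"
    using sum_shift1[of "\<lambda>i. u i + t i" "-1"] by (simp add: u_per t_per sum.distrib)
  have 2: "(\<Sum>j<n. x (int j + 1) + t (int j + 1)) = X + (\<Sum>j<n. t (int j))"
    using sum_shift1[of "\<lambda>i. x i + t i" "1"] by (simp add: x_per t_per sum.distrib)
  have "(\<Sum>j<n. y (int j)) = U + (\<Sum>j<n. u (int j - 1) + t (int j - 1)) - (\<Sum>j<n. x (int j + 1) + t (int j + 1))"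
    by (simp only: cyc_eta_def sum.distrib sum_subtractf)
  then show ?thesis using 1 2 by simp
qed

text \<open>\<open>y i - u i\<close> is the difference of the two terms whose minimum
  \<open>three_term\<close> evaluates, so \<open>min\<close> and \<open>max\<close> of
  \<open>u i\<close> and \<open>y i\<close> become explicit.\<close>

lemma min_y: "min (u i) (y i) = u i + min (u i) (x i) + t i - (x (i + 1) + t (i + 1))"
  using three_term[of i] by (simp add: cyc_eta_def min_def split: if_splits)

lemma max_y: "max (u i) (y i) = u i + (u (i - 1) + t (i - 1)) - (min (u i) (x i) + t i)"
  using three_term[of i] by (simp add: cyc_eta_def min_def max_def split: if_splits)

text \<open>All values of \<open>t\<close> cancel between \<open>min_y\<close> at \<open>i\<close>
  and \<open>max_y\<close> at \<open>i + 1\<close>; what remains uses that sum minus minimum is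
  maximum.\<close>

lemma interval_length: "min (u i) (y i) - max (u (i + 1)) (y (i + 1)) = min (u i) (x i) - max (u (i + 1)) (x (i + 1))"
  using min_y[of i] max_y[of "i + 1"] by (simp add: min_def max_def split: if_splits)

lemma sum_min_y: "(\<Sum>j<n. min (u (int j)) (y (int j))) = U - X + (\<Sum>j<n. min (u (int j)) (x (int j)))"
proof -
  have "(\<Sum>j<n. x (int j + 1) + t (int j + 1)) = X + (\<Sum>j<n. t (int j))"
    using sum_shift1[of "\<lambda>i. x i + t i" "1"] by (simp add: x_per t_per sum.distrib)
  then show ?thesis by (simp add: min_y sum.distrib sum_subtractf)
qed

text \<open>Cycle lemma: when the totals agree, the partial sums of \<open>x - u\<close> are
  periodic, and counted from a place where they are minimal they are all nonnegative. This supplies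
  the degenerate case of \<open>telescoping_min\<close>.\<close>

lemma exists_M_ge:
  assumes UX: "U = X"
  shows "\<exists>k<n. U \<le> M (i + int k)"
proof -
  define s where "s k = (\<Sum>j<k. x (i + 1 + int j) - u (i + 1 + int j))" for k
  have s_n: "s n = 0"
    using UX periodic_sum[where f = x and n = n and i = "i + 1", OF x_per]
      periodic_sum[where f = u and n = n and i = "i + 1", OF u_per] by (simp add: s_def sum_subtractf)
  have s_add: "s (k + l) = s k + (\<Sum>j<l. x (i + int k + 1 + int j) - u (i + int k + 1 + int j))" for k l
    by (induction l) (simp_all add: s_def algebra_simps)
  have s_per: "s (n + l) = s l" for l
  proof -
    have "x (i + int n + 1 + int j) = x (i + 1 + int j)" "u (i + int n + 1 + int j) = u (i + 1 + int j)" for j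
      using x_per[of "i + 1 + int j"] u_per[of "i + 1 + int j"] by (simp_all add: algebra_simps)
    then show ?thesis using s_add[of n l] s_n by (simp add: s_def)
  qed
  obtain k where k: "k < n" "\<And>l. l < n \<Longrightarrow> s k \<le> s l"
  proof -
    have "Min (s ` {..<n}) \<in> s ` {..<n}" using n by (intro Min_in) (auto simp: lessThan_empty_iff)
    then obtain k where "k < n" "s k = Min (s ` {..<n})" by auto
    then show ?thesis using that by simp
  qed
  have "U \<le> mixed (i + int k) l" if l: "l \<in> {1..<n}" for l
  proof -
    have "s k \<le> s (k + l)"
    proof (cases "k + l < n")
      case False
      then have "k + l = n + (k + l - n)" "k + l - n < n" using l k by auto
      then show ?thesis using s_per[of "k + l - n"] k(2)[of "k + l - n"] by simp
    qed (rule k)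
    moreover have "mixed (i + int k) l = U + (\<Sum>j<l. x (i + int k + 1 + int j) - u (i + int k + 1 + int j))"
    proof -
      have "{..<n} = {..<l} \<union> {l..<n}" using l by auto
      then have "(\<Sum>j<n. u (i + int k + 1 + int j)) = (\<Sum>j<l. u (i + int k + 1 + int j)) + (\<Sum>j\<in>{l..<n}. u (i + int k + 1 + int j))"
        by (simp add: sum.union_disjoint[symmetric] ivl_disj_int)
      then show ?thesis
        using periodic_sum[where f = u and n = n and i = "i + int k + 1", OF u_per] by (simp add: mixed_def sum_subtractf)
    qed
    ultimately show ?thesis using s_add[of k l] by simp
  qed
  then have "U \<le> M (i + int k)" unfolding M_def using n by (intro Min.boundedI) auto
  then show ?thesis using k by blast
qed

text \<open>Partial sums of \<open>y\<close> telescope, as \<open>y (i + 1 + j)\<close> is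
  \<open>u (i + 1 + j) + V j - W (Suc j)\<close>. Moreover \<open>V k\<close> and \<open>W k\<close>
  are the minima of \<open>U\<close> and of \<open>X\<close> with the same number
  \<open>M (i + k)\<close>, so \<open>telescoping_min\<close> evaluates the minimum.\<close>

lemma tau_y: "cyc_tau n u y i = U - X + x (i + 1) + t (i + 1) - u i"
proof -
  define V where "V k = u (i + int k) + t (i + int k)" for k
  define W where "W k = x (i + int k + 1) + t (i + int k + 1)" for k
  have "(\<Sum>k<n. V k - W k) = (\<Sum>k<n. V k) - (\<Sum>k<n. W k)" by (rule sum_subtractf)
  also have "(\<Sum>k<n. V k) = U + (\<Sum>j<n. t (int j))"
    using periodic_sum[of "\<lambda>i. u i + t i" n i] by (simp add: V_def u_per t_per sum.distrib)
  also have "(\<Sum>k<n. W k) = X + (\<Sum>j<n. t (int j))"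
    using periodic_sum[of "\<lambda>i. x i + t i" n "i + 1"] by (simp add: W_def x_per t_per sum.distrib algebra_simps)
  finally have "(\<Sum>k<n. V k - W k) = U - X" by simp
  note tm = telescoping_min[where M = "\<lambda>k. M (i + int k)", OF _ _ this exists_M_ge]
  have tm1: "\<forall>k<n. - X \<le> (\<Sum>j<k. V j - W j) - W k" and tm2: "\<exists>k<n. (\<Sum>j<k. V j - W j) - W k = - X"
    by (rule tm; simp add: V_def W_def u_plus_t x_plus_t)+
  have entry_sum: "(\<Sum>j<k. y (i + 1 + int j)) + (\<Sum>j\<in>{k..<n-1}. u (i + 1 + int j))
      = U - u i + W 0 + ((\<Sum>j<k. V j - W j) - W k)" if "k < n" for k
  proof -
    have "{..<n-1} = {..<k} \<union> {k..<n-1}" using that by auto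
    then have "(\<Sum>j<n-1. u (i + 1 + int j)) = (\<Sum>j<k. u (i + 1 + int j)) + (\<Sum>j\<in>{k..<n-1}. u (i + 1 + int j))"
      by (simp add: sum.union_disjoint[symmetric] ivl_disj_int)
    moreover have "(\<Sum>j<n-1. u (i + 1 + int j)) + u i = U"
    proof -
      have "(\<Sum>j<Suc (n-1). u (i + int j)) = U"
        using periodic_sum[where f = u and n = n and i = i, OF u_per] n by (simp del: sum.lessThan_Suc)
      then show ?thesis by (simp add: sum.lessThan_Suc_shift algebra_simps del: sum.lessThan_Suc)
    qed
    moreover have "(\<Sum>j<k. y (i + 1 + int j)) = (\<Sum>j<k. u (i + 1 + int j)) + (\<Sum>j<k. V j - W (Suc j))"
      by (simp add: cyc_eta_def V_def W_def sum.distrib sum_subtractf algebra_simps)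
    moreover have "(\<Sum>j<k. V j - W (Suc j)) = (\<Sum>j<k. V j - W j) - W k + W 0"
      by (induction k) simp_all
    ultimately show ?thesis by simp
  qed
  have "cyc_tau n u y i = Min ((\<lambda>k. U - u i + W 0 + ((\<Sum>j<k. V j - W j) - W k)) ` {..<n})"
    unfolding cyc_tau_def by (intro arg_cong[where f = Min] image_cong refl entry_sum) auto
  also have "\<dots> = U - u i + W 0 - X"
  proof (rule Min_eqI)
    obtain k where "k < n" "(\<Sum>j<k. V j - W j) - W k = - X" using tm2 by blast
    then show "U - u i + W 0 - X \<in> (\<lambda>k. U - u i + W 0 + ((\<Sum>j<k. V j - W j) - W k)) ` {..<n}"
      by (intro image_eqI[where x = k]) simp_all
  qed (use tm1 in force)+
  finally show ?thesis by (simp add: W_def)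
qed

lemma involution: "cyc_eta n u y i = x i"
  unfolding cyc_eta_def[of n u y] tau_y by (simp add: cyc_eta_def)

end

section \<open>Gelfand--Tsetlin numbers and Pieri rules\<close>

text \<open>\<open>c\<close> is the exponent of the last variable. The zeros from \<open>n\<close>
  on only make \<open>k\<close> unique as a function; they are not entries of the row, which may be
  negative.\<close>

definition interlacing :: "nat \<Rightarrow> (nat \<Rightarrow> int) \<Rightarrow> int \<Rightarrow> (nat \<Rightarrow> int) set" where
  "interlacing n l c = {k. (\<forall>i<n. l (Suc i) \<le> k i \<and> k i \<le> l i) \<and> (\<forall>i\<ge>n. k i = 0) \<and>
     (\<Sum>i<Suc n. l i) - (\<Sum>i<n. k i) = c}"

text \<open>The number of Gelfand--Tsetlin patterns with top row \<open>l 0, \<dots>, l (n - 1)\<close> and content \<open>m\<close>: the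
  coefficient of \<open>x\<^sup>m\<close> in the Schur Laurent polynomial of \<open>l\<close> in \<open>n\<close> variables. Entries may be
  negative; only the values at arguments below \<open>n\<close> matter.\<close>

fun gt_number :: "nat \<Rightarrow> (nat \<Rightarrow> int) \<Rightarrow> (nat \<Rightarrow> int) \<Rightarrow> int" where
  "gt_number 0 l m = 1"
| "gt_number (Suc n) l m = (\<Sum>k\<in>interlacing n l (m n). gt_number n k m)"

text \<open>These are the exponent vectors of the monomials in h_b; there are none for negative
  \<open>b\<close>.\<close>

definition compositions :: "nat \<Rightarrow> int \<Rightarrow> (nat \<Rightarrow> int) set" where
  "compositions n b = {q. (\<forall>i<n. 0 \<le> q i) \<and> (\<forall>i\<ge>n. q i = 0) \<and> (\<Sum>i<n. q i) = b}"

definition strips_up :: "nat \<Rightarrow> (nat \<Rightarrow> int) \<Rightarrow> int \<Rightarrow> (nat \<Rightarrow> int) set" where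
  "strips_up n l b = {k. (\<forall>i<n. l i \<le> k i) \<and> (\<forall>i. Suc i < n \<longrightarrow> k (Suc i) \<le> l i) \<and> (\<forall>i\<ge>n. k i = 0) \<and>
     (\<Sum>i<n. k i) - (\<Sum>i<n. l i) = b}"

text \<open>The last entry has no lower bound and may become negative. This is the removal that
  corresponds to multiplication by h_a in the inverse variables.\<close>

definition strips_down :: "nat \<Rightarrow> (nat \<Rightarrow> int) \<Rightarrow> int \<Rightarrow> (nat \<Rightarrow> int) set" where
  "strips_down n l a = {k. (\<forall>i<n. k i \<le> l i) \<and> (\<forall>i. Suc i < n \<longrightarrow> l (Suc i) \<le> k i) \<and> (\<forall>i\<ge>n. k i = 0) \<and>
     (\<Sum>i<n. l i) - (\<Sum>i<n. k i) = a}"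

lemma finite_box:
  "finite {f :: nat \<Rightarrow> int. (\<forall>i<n. A i \<le> f i \<and> f i \<le> B i) \<and> (\<forall>i\<ge>n. f i = 0)}"
proof (rule finite_subset)
  show "finite {f :: nat \<Rightarrow> int. \<forall>x. (x \<in> {..<n} \<longrightarrow> f x \<in> (\<Union>i<n. {A i..B i})) \<and> (x \<notin> {..<n} \<longrightarrow> f x = 0)}"
    by (intro finite_set_of_finite_funs) auto
qed auto

lemma finite_ilace: "finite (interlacing n l c)"
  by (rule finite_subset[OF _ finite_box[of n "\<lambda>i. l (Suc i)" l]]) (auto simp: interlacing_def)

lemma le_sum_int:
  fixes f :: "nat \<Rightarrow> int"
  assumes "\<forall>i<n. 0 \<le> f i" "i < n"
  shows "f i \<le> (\<Sum>i<n. f i)"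
  using assms by (intro member_le_sum) auto

lemma finite_up: "finite (strips_up n l b)"
proof (rule finite_subset[OF _ finite_box[of n l "\<lambda>i. l i + b"]])
  have "k i \<le> l i + b" if "k \<in> strips_up n l b" "i < n" for k i
    using le_sum_int[of n "\<lambda>i. k i - l i" i] that by (auto simp: strips_up_def sum_subtractf)
  then show "strips_up n l b \<subseteq> {f. (\<forall>i<n. l i \<le> f i \<and> f i \<le> l i + b) \<and> (\<forall>i\<ge>n. f i = 0)}"
    by (auto simp: strips_up_def)
qed

lemma finite_down: "finite (strips_down n l b)"
proof (rule finite_subset[OF _ finite_box[of n "\<lambda>i. l i - b" l]])
  have "k i \<ge> l i - b" if "k \<in> strips_down n l b" "i < n" for k i
    using le_sum_int[of n "\<lambda>i. l i - k i" i] that by (auto simp: strips_down_def sum_subtractf)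
  then show "strips_down n l b \<subseteq> {f. (\<forall>i<n. l i - b \<le> f i \<and> f i \<le> l i) \<and> (\<forall>i\<ge>n. f i = 0)}"
    by (auto simp: strips_down_def)
qed

lemma finite_comps: "finite (compositions n b)"
proof (rule finite_subset[OF _ finite_box[of n "\<lambda>i. 0" "\<lambda>i. b"]])
  show "compositions n b \<subseteq> {f. (\<forall>i<n. 0 \<le> f i \<and> f i \<le> b) \<and> (\<forall>i\<ge>n. f i = 0)}"
    using le_sum_int by (auto simp: compositions_def)
qed

lemma gt_cong: "(\<And>i. i < n \<Longrightarrow> m i = m' i) \<Longrightarrow> gt_number n l m = gt_number n l m'"
proof (induction n arbitrary: l)
  case (Suc n)
  have "gt_number n k m = gt_number n k m'" for k by (rule Suc.IH) (use Suc.prems in auto)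
  then show ?case using Suc.prems[of n] by simp
qed simp

lemma sum_comps_Suc:
  "(\<Sum>q\<in>compositions (Suc n) b. F q) = (\<Sum>c\<in>{0..b}. \<Sum>q\<in>compositions n (b - c). F (q(n := c)))"
proof -
  have "(\<Sum>c\<in>{0..b}. \<Sum>q\<in>compositions n (b - c). F (q(n := c)))
      = (\<Sum>(c, q)\<in>(SIGMA c:{0..b}. compositions n (b - c)). F (q(n := c)))"
    by (rule sum.Sigma) (auto simp: finite_comps)
  also have "\<dots> = (\<Sum>q\<in>compositions (Suc n) b. F q)"
  proof (rule sum.reindex_bij_witness[where j = "\<lambda>(c, q). q(n := c)" and i = "\<lambda>q. (q n, q(n := 0))"])
    fix q assume q: "q \<in> compositions (Suc n) b"
    then have "0 \<le> (\<Sum>i<n. q i)" by (intro sum_nonneg) (auto simp: compositions_def)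
    then show "(q n, q(n := 0)) \<in> (SIGMA c:{0..b}. compositions n (b - c))"
      using q by (auto simp: compositions_def)
    show "(case (q n, q(n := 0)) of (c, q) \<Rightarrow> q(n := c)) = q" by simp
  qed (auto simp: compositions_def fun_eq_iff)
  finally show ?thesis ..
qed

text \<open>Splitting off the last variable reduces both Pieri rules to a count of integer points in one and
  the same box, one side bounding the coordinate sum from below and the other from above. The
  reflection of the box exchanges the two bounds.\<close>

theorem pieri_up: "(\<Sum>q\<in>compositions n b. gt_number n l (\<lambda>i. m i - q i)) = (\<Sum>k\<in>strips_up n l b. gt_number n k m)"
proof (induction n arbitrary: l b)
  case 0
  have "compositions 0 b = strips_up 0 l b" by (auto simp: compositions_def strips_up_def)
  then show ?case by simp
next
  case (Suc n)
  let ?L = "SIGMA c:{0..b}. SIGMA k:interlacing n l (m n - c). strips_up n k (b - c)"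
  let ?R = "SIGMA k:strips_up (Suc n) l b. interlacing n k (m n)"
  \<comment> \<open>For a fixed remaining row \<open>k\<close>, both \<open>r\<close> and the tail
    of \<open>v\<close> range over the box from \<open>mx k (Suc i)\<close> to
    \<open>hi k i\<close>. Since \<open>k\<close> has only \<open>n\<close> entries, the last lower
    bound is \<open>l n\<close> alone.\<close>
  define mx where "mx k i = (if i < n then max (l i) (k i) else l i)" for k :: "nat \<Rightarrow> int" and i
  define hi where "hi k i = min (l i) (k i)" for k :: "nat \<Rightarrow> int" and i
  \<comment> \<open>Maximum plus minimum is the sum, so the bounds of the box have a known total.
    This is what makes the reflection turn \<open>0 \<le> c\<close> into
    \<open>mx k 0 \<le> v 0\<close>.\<close>
  have sums: "(\<Sum>i<n. mx k (Suc i) + hi k i) = (\<Sum>i<Suc n. l i) + (\<Sum>i<n. k i) - mx k 0" for k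
  proof -
    have "(\<Sum>i<n. mx k (Suc i) + hi k i) + mx k 0 = (\<Sum>i<Suc n. mx k i) + (\<Sum>i<n. hi k i)"
      by (simp add: sum.lessThan_Suc_shift sum.distrib del: sum.lessThan_Suc)
    also have "(\<Sum>i<Suc n. mx k i) = (\<Sum>i<n. mx k i) + l n"
      by (simp add: mx_def)
    also have "(\<Sum>i<n. mx k i) + l n + (\<Sum>i<n. hi k i) = (\<Sum>i<n. mx k i + hi k i) + l n"
      by (simp add: sum.distrib)
    also have "(\<Sum>i<n. mx k i + hi k i) = (\<Sum>i<n. l i + k i)"
      by (rule sum.cong) (auto simp: mx_def hi_def)
    finally show ?thesis by (simp add: sum.distrib)
  qed
  have L: "(c, r, k) \<in> ?L \<longleftrightarrow> (\<forall>i<n. mx k (Suc i) \<le> r i \<and> r i \<le> hi k i) \<and> (\<forall>i\<ge>n. r i = 0) \<and>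
     (\<forall>i\<ge>n. k i = 0) \<and> c = m n - (\<Sum>i<Suc n. l i) + (\<Sum>i<n. r i) \<and>
     (\<Sum>i<n. k i) - (\<Sum>i<Suc n. l i) = b - m n \<and> 0 \<le> c" (is "_ \<longleftrightarrow> ?P") for c r k
  proof
    assume "(c, r, k) \<in> ?L"
    then show ?P by (auto simp: interlacing_def strips_up_def mx_def hi_def)
  next
    assume P: ?P
    then have "(\<Sum>i<n. r i) \<le> (\<Sum>i<n. k i)" by (intro sum_mono) (auto simp: hi_def)
    with P have "c \<in> {0..b}" by auto
    moreover from P have "r \<in> interlacing n l (m n - c)"
      by (auto simp: interlacing_def mx_def hi_def split: if_splits)
    moreover from P have "k \<in> strips_up n r (b - c)"
      by (auto simp: strips_up_def mx_def hi_def split: if_splits)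
    ultimately show "(c, r, k) \<in> ?L" by auto
  qed
  have R: "(v, k) \<in> ?R \<longleftrightarrow> (\<forall>i<n. mx k (Suc i) \<le> v (Suc i) \<and> v (Suc i) \<le> hi k i) \<and> mx k 0 \<le> v 0 \<and>
     (\<forall>i\<ge>Suc n. v i = 0) \<and> (\<forall>i\<ge>n. k i = 0) \<and> (\<Sum>i<Suc n. v i) - (\<Sum>i<Suc n. l i) = b \<and>
     (\<Sum>i<n. k i) - (\<Sum>i<Suc n. l i) = b - m n" (is "_ \<longleftrightarrow> ?Q") for v k
  proof
    assume "(v, k) \<in> ?R"
    then show ?Q by (auto simp: interlacing_def strips_up_def mx_def hi_def)
  next
    assume Q: ?Q
    have *: "mx k i \<le> v i" if "i \<le> n" for i using Q that by (cases i) auto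
    then have "l i \<le> v i" if "i < Suc n" for i
      using that by (auto simp: mx_def split: if_splits) (smt (verit) less_Suc_eq_le)
    moreover have "k i \<le> v i" if "i < n" for i
      using that * by (auto simp: mx_def split: if_splits) (smt (verit) less_or_eq_imp_le)
    ultimately show "(v, k) \<in> ?R" using Q by (auto simp: interlacing_def strips_up_def hi_def simp del: sum.lessThan_Suc)
  qed
  \<comment> \<open>The reflection of the box; \<open>v 0\<close>, bounded only from below, absorbs
    the prescribed total.\<close>
  let ?v = "\<lambda>r k. (\<lambda>i. case i of 0 \<Rightarrow> b + (\<Sum>i<Suc n. l i) - (\<Sum>i<n. mx k (Suc i) + hi k i - r i)
     | Suc i \<Rightarrow> if i < n then mx k (Suc i) + hi k i - r i else 0)"
  let ?r = "\<lambda>v k i. if i < n then mx k (Suc i) + hi k i - v (Suc i) else 0"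
  have "(\<Sum>q\<in>compositions (Suc n) b. gt_number (Suc n) l (\<lambda>i. m i - q i))
      = (\<Sum>c\<in>{0..b}. \<Sum>q\<in>compositions n (b - c). \<Sum>k\<in>interlacing n l (m n - c). gt_number n k (\<lambda>i. m i - (q(n := c)) i))"
    by (simp add: sum_comps_Suc)
  also have "\<dots> = (\<Sum>c\<in>{0..b}. \<Sum>q\<in>compositions n (b - c). \<Sum>k\<in>interlacing n l (m n - c). gt_number n k (\<lambda>i. m i - q i))"
    by (intro sum.cong refl gt_cong) auto
  also have "\<dots> = (\<Sum>c\<in>{0..b}. \<Sum>k\<in>interlacing n l (m n - c). \<Sum>q\<in>compositions n (b - c). gt_number n k (\<lambda>i. m i - q i))"
    by (subst sum.swap) (rule refl)
  also have "\<dots> = (\<Sum>c\<in>{0..b}. \<Sum>r\<in>interlacing n l (m n - c). \<Sum>k\<in>strips_up n r (b - c). gt_number n k m)"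
    by (simp add: Suc.IH)
  also have "\<dots> = (\<Sum>(c, r, k)\<in>?L. gt_number n k m)"
    by (simp add: sum.Sigma finite_ilace finite_up)
  also have "\<dots> = (\<Sum>(v, k)\<in>?R. gt_number n k m)"
  proof (rule sum.reindex_bij_witness[where
      j = "\<lambda>(c, r, k). (?v r k, k)" and i = "\<lambda>(v, k). (m n - (\<Sum>i<Suc n. l i) + (\<Sum>i<n. ?r v k i), ?r v k, k)"])
    show "(case x of (c, r, k) \<Rightarrow> (?v r k, k)) \<in> ?R" if x: "x \<in> ?L" for x
    proof -
      obtain c r k where xe: "x = (c, r, k)" by (cases x)
      note P = x[unfolded xe L]
      have "(\<Sum>i<Suc n. ?v r k i) = b + (\<Sum>i<Suc n. l i)"
        by (simp add: sum.lessThan_Suc_shift del: sum.lessThan_Suc)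
      moreover have "mx k 0 \<le> ?v r k 0"
        using P sums[of k] by (simp add: sum_subtractf)
      ultimately show ?thesis unfolding xe prod.case R using P
        by (auto simp del: sum.lessThan_Suc split: nat.split)
    qed
    show "(case y of (v, k) \<Rightarrow> (m n - (\<Sum>i<Suc n. l i) + (\<Sum>i<n. ?r v k i), ?r v k, k)) \<in> ?L" if y: "y \<in> ?R" for y
    proof -
      obtain v k where ye: "y = (v, k)" by (cases y)
      note Q = y[unfolded ye R]
      have "(\<Sum>i<n. ?r v k i) = (\<Sum>i<n. mx k (Suc i) + hi k i) - ((\<Sum>i<Suc n. v i) - v 0)"
        by (simp add: sum_subtractf sum.lessThan_Suc_shift del: sum.lessThan_Suc)
      then have "0 \<le> m n - (\<Sum>i<Suc n. l i) + (\<Sum>i<n. ?r v k i)"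
        using Q sums[of k] by linarith
      then show ?thesis unfolding ye prod.case L using Q by auto
    qed
    show "(case (case x of (c, r, k) \<Rightarrow> (?v r k, k)) of (v, k) \<Rightarrow>
        (m n - (\<Sum>i<Suc n. l i) + (\<Sum>i<n. ?r v k i), ?r v k, k)) = x" if x: "x \<in> ?L" for x
    proof -
      obtain c r k where xe: "x = (c, r, k)" by (cases x)
      note P = x[unfolded xe L]
      have "?r (?v r k) k = r" using P by (auto simp: fun_eq_iff)
      then show ?thesis using P unfolding xe prod.case by simp
    qed
    show "(case (case y of (v, k) \<Rightarrow> (m n - (\<Sum>i<Suc n. l i) + (\<Sum>i<n. ?r v k i), ?r v k, k))
        of (c, r, k) \<Rightarrow> (?v r k, k)) = y" if y: "y \<in> ?R" for y
    proof -
      obtain v k where ye: "y = (v, k)" by (cases y)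
      note Q = y[unfolded ye R]
      have "?v (?r v k) k i = v i" for i
      proof (cases i)
        case 0
        have "(\<Sum>i<n. mx k (Suc i) + hi k i - ?r v k i) = (\<Sum>i<n. v (Suc i))"
          by (rule sum.cong) auto
        also have "\<dots> = (\<Sum>i<Suc n. v i) - v 0"
          by (simp add: sum.lessThan_Suc_shift del: sum.lessThan_Suc)
        finally show ?thesis using Q 0 by (simp del: sum.lessThan_Suc)
      next
        case (Suc j)
        then show ?thesis using Q by auto
      qed
      then have "?v (?r v k) k = v" by (rule ext)
      then show ?thesis unfolding ye prod.case by (simp only:)
    qed
  qed auto
  also have "\<dots> = (\<Sum>k\<in>strips_up (Suc n) l b. gt_number (Suc n) k m)"
    by (simp add: sum.Sigma finite_ilace finite_up)
  finally show ?case .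
qed

text \<open>The mirror image of \<open>pieri_up\<close>: the entry free on one side is now the last,
  so \<open>v n\<close> absorbs the prescribed total.\<close>

theorem pieri_down: "(\<Sum>p\<in>compositions n a. gt_number n l (\<lambda>i. m i + p i)) = (\<Sum>k\<in>strips_down n l a. gt_number n k m)"
proof (induction n arbitrary: l a)
  case 0
  have "compositions 0 a = strips_down 0 l a" by (auto simp: compositions_def strips_down_def)
  then show ?case by simp
next
  case (Suc n)
  let ?L = "SIGMA c:{0..a}. SIGMA k:interlacing n l (m n + c). strips_down n k (a - c)"
  let ?R = "SIGMA k:strips_down (Suc n) l a. interlacing n k (m n)"
  define mi where "mi k i = (case i of 0 \<Rightarrow> l 0 | Suc j \<Rightarrow> min (l i) (k j))" for k :: "nat \<Rightarrow> int" and i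
  define lo where "lo k i = max (l (Suc i)) (k i)" for k :: "nat \<Rightarrow> int" and i
  have mi_le: "mi k i \<le> l i" for k i by (cases i) (auto simp: mi_def)
  have sums: "(\<Sum>i<n. lo k i + mi k i) = (\<Sum>i<Suc n. l i) + (\<Sum>i<n. k i) - mi k n" for k
  proof -
    have "(\<Sum>i<n. lo k i + mi k i) + mi k n = (\<Sum>i<n. lo k i) + (\<Sum>i<Suc n. mi k i)"
      by (simp add: sum.distrib)
    also have "(\<Sum>i<Suc n. mi k i) = (\<Sum>i<n. mi k (Suc i)) + l 0"
      by (simp add: sum.lessThan_Suc_shift mi_def del: sum.lessThan_Suc)
    also have "(\<Sum>i<n. lo k i) + ((\<Sum>i<n. mi k (Suc i)) + l 0) = (\<Sum>i<n. lo k i + mi k (Suc i)) + l 0"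
      by (simp add: sum.distrib)
    also have "(\<Sum>i<n. lo k i + mi k (Suc i)) = (\<Sum>i<n. l (Suc i) + k i)"
      by (rule sum.cong) (auto simp: mi_def lo_def)
    finally show ?thesis by (simp add: sum.distrib sum.lessThan_Suc_shift del: sum.lessThan_Suc)
  qed
  have L: "(c, r, k) \<in> ?L \<longleftrightarrow> (\<forall>i<n. lo k i \<le> r i \<and> r i \<le> mi k i) \<and> (\<forall>i\<ge>n. r i = 0) \<and>
     (\<forall>i\<ge>n. k i = 0) \<and> c = (\<Sum>i<Suc n. l i) - (\<Sum>i<n. r i) - m n \<and>
     (\<Sum>i<Suc n. l i) - (\<Sum>i<n. k i) = a + m n \<and> 0 \<le> c" (is "_ \<longleftrightarrow> ?P") for c r k
  proof
    assume "(c, r, k) \<in> ?L"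
    then show ?P by (auto simp: interlacing_def strips_down_def mi_def lo_def split: nat.split)
  next
    assume P: ?P
    then have "(\<Sum>i<n. k i) \<le> (\<Sum>i<n. r i)" by (intro sum_mono) (auto simp: lo_def)
    with P have "c \<in> {0..a}" by auto
    moreover from P have "r \<in> interlacing n l (m n + c)"
      using mi_le by (auto simp: interlacing_def lo_def intro: order_trans)
    moreover have "r (Suc i) \<le> k i" if "Suc i < n" for i
    proof -
      have "r (Suc i) \<le> mi k (Suc i)" using P that by blast
      then show ?thesis by (simp add: mi_def)
    qed
    with P have "k \<in> strips_down n r (a - c)"
      by (auto simp: strips_down_def lo_def)
    ultimately show "(c, r, k) \<in> ?L" by auto
  qed
  have R: "(v, k) \<in> ?R \<longleftrightarrow> (\<forall>i<n. lo k i \<le> v i \<and> v i \<le> mi k i) \<and> v n \<le> mi k n \<and>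
     (\<forall>i\<ge>Suc n. v i = 0) \<and> (\<forall>i\<ge>n. k i = 0) \<and> (\<Sum>i<Suc n. l i) - (\<Sum>i<Suc n. v i) = a \<and>
     (\<Sum>i<Suc n. l i) - (\<Sum>i<n. k i) = a + m n" (is "_ \<longleftrightarrow> ?Q") for v k
  proof
    assume "(v, k) \<in> ?R"
    then show ?Q by (auto simp: interlacing_def strips_down_def mi_def lo_def split: nat.split)
  next
    assume Q: ?Q
    have *: "v i \<le> mi k i" if "i \<le> n" for i using Q that by (cases "i = n") auto
    have "v i \<le> l i" if "i < Suc n" for i
      using that *[of i] by (cases i) (auto simp: mi_def)
    moreover have "v (Suc i) \<le> k i" if "i < n" for i
      using that *[of "Suc i"] by (auto simp: mi_def)
    ultimately show "(v, k) \<in> ?R" using Q by (auto simp: interlacing_def strips_down_def lo_def simp del: sum.lessThan_Suc)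
  qed
  let ?v = "\<lambda>r k i. if i < n then lo k i + mi k i - r i
     else if i = n then (\<Sum>i<Suc n. l i) - a - (\<Sum>i<n. lo k i + mi k i - r i) else 0"
  let ?r = "\<lambda>v k i. if i < n then lo k i + mi k i - v i else 0"
  let ?c = "\<lambda>v k. (\<Sum>i<Suc n. l i) - (\<Sum>i<n. ?r v k i) - m n"
  have "(\<Sum>q\<in>compositions (Suc n) a. gt_number (Suc n) l (\<lambda>i. m i + q i))
      = (\<Sum>c\<in>{0..a}. \<Sum>q\<in>compositions n (a - c). \<Sum>k\<in>interlacing n l (m n + c). gt_number n k (\<lambda>i. m i + (q(n := c)) i))"
    by (simp add: sum_comps_Suc)
  also have "\<dots> = (\<Sum>c\<in>{0..a}. \<Sum>q\<in>compositions n (a - c). \<Sum>k\<in>interlacing n l (m n + c). gt_number n k (\<lambda>i. m i + q i))"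
    by (intro sum.cong refl gt_cong) auto
  also have "\<dots> = (\<Sum>c\<in>{0..a}. \<Sum>k\<in>interlacing n l (m n + c). \<Sum>q\<in>compositions n (a - c). gt_number n k (\<lambda>i. m i + q i))"
    by (subst sum.swap) (rule refl)
  also have "\<dots> = (\<Sum>c\<in>{0..a}. \<Sum>r\<in>interlacing n l (m n + c). \<Sum>k\<in>strips_down n r (a - c). gt_number n k m)"
    by (simp add: Suc.IH)
  also have "\<dots> = (\<Sum>(c, r, k)\<in>?L. gt_number n k m)"
    by (simp add: sum.Sigma finite_ilace finite_down)
  also have "\<dots> = (\<Sum>(v, k)\<in>?R. gt_number n k m)"
  proof (rule sum.reindex_bij_witness[where
      j = "\<lambda>(c, r, k). (?v r k, k)" and i = "\<lambda>(v, k). (?c v k, ?r v k, k)"])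
    show "(case x of (c, r, k) \<Rightarrow> (?v r k, k)) \<in> ?R" if x: "x \<in> ?L" for x
    proof -
      obtain c r k where xe: "x = (c, r, k)" by (cases x)
      note P = x[unfolded xe L]
      have "(\<Sum>i<Suc n. ?v r k i) = (\<Sum>i<Suc n. l i) - a"
        by simp
      moreover have "?v r k n \<le> mi k n"
        using P sums[of k] by (simp add: sum_subtractf)
      ultimately show ?thesis unfolding xe prod.case R using P
        by (auto simp del: sum.lessThan_Suc)
    qed
    show "(case y of (v, k) \<Rightarrow> (?c v k, ?r v k, k)) \<in> ?L" if y: "y \<in> ?R" for y
    proof -
      obtain v k where ye: "y = (v, k)" by (cases y)
      note Q = y[unfolded ye R]
      have "(\<Sum>i<n. ?r v k i) = (\<Sum>i<n. lo k i + mi k i) - ((\<Sum>i<Suc n. v i) - v n)"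
        by (simp add: sum_subtractf)
      then have "0 \<le> ?c v k"
        using Q sums[of k] by linarith
      then show ?thesis unfolding ye prod.case L using Q by auto
    qed
    show "(case (case x of (c, r, k) \<Rightarrow> (?v r k, k)) of (v, k) \<Rightarrow> (?c v k, ?r v k, k)) = x"
      if x: "x \<in> ?L" for x
    proof -
      obtain c r k where xe: "x = (c, r, k)" by (cases x)
      note P = x[unfolded xe L]
      have "?r (?v r k) k = r" using P by (auto simp: fun_eq_iff)
      then show ?thesis using P unfolding xe prod.case by simp
    qed
    show "(case (case y of (v, k) \<Rightarrow> (?c v k, ?r v k, k)) of (c, r, k) \<Rightarrow> (?v r k, k)) = y"
      if y: "y \<in> ?R" for y
    proof -
      obtain v k where ye: "y = (v, k)" by (cases y)
      note Q = y[unfolded ye R]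
      have "(\<Sum>i<n. lo k i + mi k i - ?r v k i) = (\<Sum>i<n. v i)"
        by (rule sum.cong) auto
      then have "?v (?r v k) k i = v i" for i
        using Q by auto
      then have "?v (?r v k) k = v" by (rule ext)
      then show ?thesis unfolding ye prod.case by (simp only:)
    qed
  qed auto
  also have "\<dots> = (\<Sum>k\<in>strips_down (Suc n) l a. gt_number (Suc n) k m)"
    by (simp add: sum.Sigma finite_ilace finite_down)
  finally show ?case .
qed

text \<open>Multiplication by a power of the product of all variables. It carries the translation
  between \<omega> and \<nu>, and the one between \<alpha> and the row (b, 0, ..., 0, -a).\<close>

lemma gt_shift:
  "gt_number n (\<lambda>i. if i < n then l i + c else 0) (\<lambda>i. m i + c) = gt_number n l m"
proof (induction n arbitrary: l)
  case (Suc n)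
  show ?case unfolding gt_number.simps
  proof (rule sum.reindex_bij_witness[where j = "\<lambda>k i. if i < n then k i - c else 0"
        and i = "\<lambda>k i. if i < n then k i + c else 0"])
    fix k
    assume k: "k \<in> interlacing n (\<lambda>i. if i < Suc n then l i + c else 0) (m n + c)"
    show "(\<lambda>i. if i < n then (if i < n then k i - c else 0) + c else 0) = k"
      using k by (auto simp: interlacing_def)
    have "sum k {..<n} = (\<Sum>i<n. k i - c) + int n * c" by (simp add: sum_subtractf)
    then show "(\<lambda>i. if i < n then k i - c else 0) \<in> interlacing n l (m n)"
      using k by (auto simp: interlacing_def sum.distrib algebra_simps)
    have "gt_number n (\<lambda>i. if i < n then k i - c else 0) m
       = gt_number n (\<lambda>i. if i < n then (if i < n then k i - c else 0) + c else 0) (\<lambda>i. m i + c)"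
      by (rule Suc.IH[symmetric])
    also have "(\<lambda>i. if i < n then (if i < n then k i - c else 0) + c else 0) = k"
      using k by (auto simp: interlacing_def)
    finally show "gt_number n (\<lambda>i. if i < n then k i - c else 0) m = gt_number n k (\<lambda>i. m i + c)" .
  next
    fix k assume k: "k \<in> interlacing n l (m n)"
    show "(\<lambda>i. if i < n then (if i < n then k i + c else 0) - c else 0) = k"
      using k by (auto simp: interlacing_def)
    show "(\<lambda>i. if i < n then k i + c else 0) \<in> interlacing n (\<lambda>i. if i < Suc n then l i + c else 0) (m n + c)"
      using k by (auto simp: interlacing_def sum.distrib algebra_simps)
  qed
qed simp

section \<open>Positivity, dominance and linear independence of pattern counts\<close>

lemma ilace_nonneg:
  assumes "\<forall>i\<le>n. 0 \<le> l i" "k \<in> interlacing n l c"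
  shows "\<forall>i<n. 0 \<le> k i" "0 \<le> c"
proof -
  show "\<forall>i<n. 0 \<le> k i" using assms by (auto simp: interlacing_def) (meson Suc_leI order_trans)
  have "(\<Sum>i<n. k i) \<le> (\<Sum>i<n. l i)" using assms by (intro sum_mono) (auto simp: interlacing_def)
  then show "0 \<le> c" using assms by (auto simp: interlacing_def)
qed

lemma gt_neq_0_imp_nonneg:
  assumes "gt_number n l m \<noteq> 0" "\<forall>i<n. 0 \<le> l i" "i < n"
  shows "0 \<le> m i"
  using assms
proof (induction n arbitrary: l)
  case (Suc n)
  from Suc.prems(1) obtain k where k: "k \<in> interlacing n l (m n)" "gt_number n k m \<noteq> 0"
    by (auto elim: sum.not_neutral_contains_not_neutral)
  note nn = ilace_nonneg[OF _ k(1)]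
  show ?case
  proof (cases "i = n")
    case True
    then show ?thesis using nn(2) Suc.prems by auto
  next
    case False
    then show ?thesis using Suc.IH[OF k(2)] nn(1) Suc.prems by auto
  qed
qed simp

text \<open>The first \<open>j\<close> exponents add up to the total of the row of length
  \<open>j\<close>, whose entries are bounded by the first \<open>j\<close> entries of the top
  row.\<close>

lemma gt_neq_0_imp_dominance:
  assumes "gt_number n l m \<noteq> 0"
  shows "(\<Sum>i<n. m i) = (\<Sum>i<n. l i)" "j \<le> n \<Longrightarrow> (\<Sum>i<j. m i) \<le> (\<Sum>i<j. l i)"
proof -
  have "(\<Sum>i<n. m i) = (\<Sum>i<n. l i) \<and> (j \<le> n \<longrightarrow> (\<Sum>i<j. m i) \<le> (\<Sum>i<j. l i))"
    using assms
  proof (induction n arbitrary: l)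
    case (Suc n)
    from Suc.prems(1) obtain k where k: "k \<in> interlacing n l (m n)" "gt_number n k m \<noteq> 0"
      by (auto elim: sum.not_neutral_contains_not_neutral)
    have sum: "(\<Sum>i<Suc n. m i) = (\<Sum>i<Suc n. l i)"
      using Suc.IH[OF k(2)] k(1) by (auto simp: interlacing_def)
    have "(\<Sum>i<j. k i) \<le> (\<Sum>i<j. l i)" if "j \<le> n"
      using k(1) that by (intro sum_mono) (auto simp: interlacing_def)
    then show ?case using sum Suc.IH[OF k(2)] by (cases "j = Suc n") auto
  qed simp
  then show "(\<Sum>i<n. m i) = (\<Sum>i<n. l i)" "j \<le> n \<Longrightarrow> (\<Sum>i<j. m i) \<le> (\<Sum>i<j. l i)" by auto
qed

text \<open>Only one next row contributes: its partial sums are at most those of \<open>l\<close> by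
  interlacing and at least those of \<open>l\<close> by dominance.\<close>

lemma gt_self:
  assumes "\<And>i. Suc i < n \<Longrightarrow> l (Suc i) \<le> l i"
  shows "gt_number n l l = 1"
  using assms
proof (induction n arbitrary: l)
  case (Suc n)
  let ?k = "\<lambda>i. if i < n then l i else 0"
  have "gt_number n k l = (if k = ?k then 1 else 0)" if k: "k \<in> interlacing n l (l n)" for k
  proof (cases "gt_number n k l = 0")
    case True
    have "gt_number n ?k ?k = 1" using Suc.prems by (intro Suc.IH) auto
    also have "gt_number n ?k ?k = gt_number n ?k l" by (rule gt_cong) auto
    finally show ?thesis using True by auto
  next
    case False
    have "(\<Sum>i<j. k i) = (\<Sum>i<j. l i)" if "j \<le> n" for j
    proof (rule antisym)
      show "(\<Sum>i<j. k i) \<le> (\<Sum>i<j. l i)"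
        using that k by (intro sum_mono) (auto simp: interlacing_def)
    qed (rule gt_neq_0_imp_dominance(2)[OF False that])
    then have "k i = l i" if "i < n" for i
      using that by (metis Suc_leI add_left_cancel less_or_eq_imp_le sum.lessThan_Suc)
    then have "k = ?k" using k by (auto simp: interlacing_def)
    moreover have "gt_number n ?k l = gt_number n ?k ?k" by (rule gt_cong) auto
    moreover have "gt_number n ?k ?k = 1" using Suc.prems by (intro Suc.IH) auto
    ultimately show ?thesis by simp
  qed
  then have "gt_number (Suc n) l l = (\<Sum>k\<in>interlacing n l (l n). if k = ?k then 1 else 0)" by simp
  also have "\<dots> = 1"
  proof -
    have "?k \<in> interlacing n l (l n)" using Suc.prems by (auto simp: interlacing_def)
    then show ?thesis by (simp add: finite_ilace)
  qed
  finally show ?case .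
qed simp

text \<open>Unitriangularity in dominance order, encoded as the pointwise order on the partial sums
  \<open>g\<close>: if \<open>m\<close> is maximal among the rows with nonzero coefficient, the
  equation at \<open>m\<close> retains only the term of \<open>m\<close> itself.\<close>

lemma gt_independent:
  fixes c :: "(nat \<Rightarrow> int) \<Rightarrow> int"
  assumes fin: "finite A" and A: "\<And>l. l \<in> A \<Longrightarrow> (\<forall>i. Suc i < n \<longrightarrow> l (Suc i) \<le> l i) \<and> (\<forall>i\<ge>n. l i = 0)"
    and eq: "\<And>m. m \<in> A \<Longrightarrow> (\<Sum>l\<in>A. c l * gt_number n l m) = 0"
  shows "\<forall>l\<in>A. c l = 0"
proof (rule ccontr)
  assume neg: "\<not> (\<forall>l\<in>A. c l = 0)"
  define g :: "(nat \<Rightarrow> int) \<Rightarrow> nat \<Rightarrow> int" where "g l j = (\<Sum>i<min j n. l i)" for l j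
  define S where "S = {l \<in> A. c l \<noteq> 0}"
  have "finite (g ` S)" "g ` S \<noteq> {}" using fin neg by (auto simp: S_def)
  then obtain m where m: "m \<in> S" and max: "\<And>l. l \<in> S \<Longrightarrow> g m \<le> g l \<Longrightarrow> g m = g l"
    using finite_has_maximal[of "g ` S"] by auto
  have mA: "m \<in> A" using m by (simp add: S_def)
  have "c l * gt_number n l m = (if l = m then c m else 0)" if l: "l \<in> A" for l
  proof (cases "l \<in> S \<and> gt_number n l m \<noteq> 0")
    case True
    then have "g m \<le> g l" using gt_neq_0_imp_dominance(2)[of n l m] by (auto simp: le_fun_def g_def)
    with max True have *: "g m j = g l j" for j by metis
    have "m i = l i" for i
    proof (cases "i < n")
      case True
      then show ?thesis using *[of i] *[of "Suc i"] by (simp add: g_def min_def)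
    qed (use A[OF l] A[OF mA] in simp)
    then have "l = m" by auto
    then show ?thesis using gt_self[of n m] A[OF mA] by simp
  next
    case False
    then have "c l * gt_number n l m = 0" using l by (auto simp: S_def)
    moreover have "gt_number n m m = 1" using gt_self[of n m] A[OF mA] by simp
    ultimately show ?thesis using False m by auto
  qed
  then have "(\<Sum>l\<in>A. c l * gt_number n l m) = c m" using fin mA by simp
  then show False using eq[OF mA] m by (simp add: S_def)
qed

section \<open>Adding and removing horizontal strips\<close>

lemma gt_zero: "gt_number n (\<lambda>i. 0) m = (if \<forall>i<n. m i = 0 then 1 else 0)"
proof -
  have "gt_number n (\<lambda>i. 0) m = 0" if "i < n" "m i \<noteq> 0" for i
  proof (rule ccontr)
    assume ne: "gt_number n (\<lambda>i. 0) m \<noteq> 0"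
    have "0 \<le> m j" if "j < n" for j using gt_neq_0_imp_nonneg[OF ne] that by simp
    then have "m i \<le> (\<Sum>j<n. m j)" "0 \<le> m i" using that by (auto intro: le_sum_int)
    then show False using gt_neq_0_imp_dominance(1)[OF ne] that by simp
  qed
  moreover have "gt_number n (\<lambda>i. 0) m = 1" if "\<forall>i<n. m i = 0"
    using gt_self[of n "\<lambda>i. 0"] gt_cong[of n m "\<lambda>i. 0"] that by simp
  ultimately show ?thesis by auto
qed

text \<open>The coefficient at \<open>m\<close> of the Laurent polynomial \<open>f\<close>
  multiplied by h_b(x) h_a(x^-1). The degrees are integers so that \<open>b - 1\<close> or
  \<open>a - 1\<close> may be -1, where the sum is empty.\<close>

definition add_remove :: "nat \<Rightarrow> int \<Rightarrow> int \<Rightarrow> ((nat \<Rightarrow> int) \<Rightarrow> int) \<Rightarrow> (nat \<Rightarrow> int) \<Rightarrow> int" where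
  "add_remove n b a f m = (\<Sum>q\<in>compositions n b. \<Sum>p\<in>compositions n a. f (\<lambda>i. m i - q i + p i))"

text \<open>The condition on \<open>k 0\<close> is what survives of the difference of two consecutive \<open>add_remove\<close>
  terms: increasing the first part of \<open>k\<close> is the only freedom not bounded by \<open>l\<close> and \<open>v\<close>.\<close>

definition connecting :: "nat \<Rightarrow> (nat \<Rightarrow> int) \<Rightarrow> (nat \<Rightarrow> int) \<Rightarrow> int \<Rightarrow> int \<Rightarrow> (nat \<Rightarrow> int) set" where
  "connecting n l v b a = {k \<in> strips_up n l b. v \<in> strips_down n k a \<and> k 0 = max (l 0) (v 0)}"

lemma add_remove_gt:
  "add_remove n b a (gt_number n l) m = (\<Sum>(k, v)\<in>(SIGMA k:strips_up n l b. strips_down n k a). gt_number n v m)"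
proof -
  have "add_remove n b a (gt_number n l) m = (\<Sum>p\<in>compositions n a. \<Sum>q\<in>compositions n b. gt_number n l (\<lambda>i. (m i + p i) - q i))"
    unfolding add_remove_def by (subst sum.swap) (simp add: algebra_simps)
  also have "\<dots> = (\<Sum>p\<in>compositions n a. \<Sum>k\<in>strips_up n l b. gt_number n k (\<lambda>i. m i + p i))"
    by (simp only: pieri_up)
  also have "\<dots> = (\<Sum>k\<in>strips_up n l b. \<Sum>p\<in>compositions n a. gt_number n k (\<lambda>i. m i + p i))"
    by (rule sum.swap)
  also have "\<dots> = (\<Sum>k\<in>strips_up n l b. \<Sum>v\<in>strips_down n k a. gt_number n v m)"
    by (simp only: pieri_down)
  finally show ?thesis by (simp add: sum.Sigma finite_up finite_down)
qed

lemma sum_upd_0: "0 < n \<Longrightarrow> (\<Sum>i<n. (k(0 := c)) i) = (\<Sum>i<n. k i) - k 0 + (c :: int)" for k :: "nat \<Rightarrow> int"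
  by (cases n) (simp_all add: sum.lessThan_Suc_shift del: sum.lessThan_Suc)

lemma add_remove_diff:
  assumes n: "0 < n"
  shows "add_remove n b a (gt_number n l) m - add_remove n (b - 1) (a - 1) (gt_number n l) m
     = (\<Sum>(k, v)\<in>{(k, v). k \<in> strips_up n l b \<and> v \<in> strips_down n k a \<and> k 0 = max (l 0) (v 0)}. gt_number n v m)"
proof -
  let ?P = "\<lambda>b a. SIGMA k:strips_up n l b. strips_down n k a"
  let ?E = "{(k, v). k \<in> strips_up n l b \<and> v \<in> strips_down n k a \<and> k 0 = max (l 0) (v 0)}"
  have fin: "finite (?P b a)" by (auto simp: finite_up finite_down)
  have sub: "?E \<subseteq> ?P b a" by auto
  have "add_remove n (b - 1) (a - 1) (gt_number n l) m = (\<Sum>(k, v)\<in>?P b a - ?E. gt_number n v m)"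
    unfolding add_remove_gt
  \<comment> \<open>Raising \<open>k 0\<close> by one enlarges both strips and is always allowed;
    the pairs missed are those where \<open>k 0\<close> sits at its lower bound.\<close>
  proof (rule sum.reindex_bij_witness[where j = "\<lambda>(k, v). (k(0 := k 0 + 1), v)" and i = "\<lambda>(k, v). (k(0 := k 0 - 1), v)"])
    fix y assume "y \<in> ?P b a - ?E"
    then obtain k v where y: "y = (k, v)" and k: "k \<in> strips_up n l b" and v: "v \<in> strips_down n k a" and "k 0 \<noteq> max (l 0) (v 0)"
      by (cases y) auto
    moreover have "l 0 \<le> k 0" "v 0 \<le> k 0" using k v n by (auto simp: strips_up_def strips_down_def)
    ultimately have less: "l 0 < k 0" "v 0 < k 0" by auto
    have "k(0 := k 0 - 1) \<in> strips_up n l (b - 1)"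
      using k less n by (auto simp: strips_up_def sum_upd_0[OF n] simp del: fun_upd_apply) (auto simp: all_conj_distrib)
    moreover have "v \<in> strips_down n (k(0 := k 0 - 1)) (a - 1)"
      using v less n by (auto simp: strips_down_def sum_upd_0[OF n] simp del: fun_upd_apply) (auto simp: all_conj_distrib)
    ultimately show "(case y of (k, v) \<Rightarrow> (k(0 := k 0 - 1), v)) \<in> ?P (b - 1) (a - 1)" by (simp add: y)
  next
    fix y assume "y \<in> ?P (b - 1) (a - 1)"
    then obtain k v where y: "y = (k, v)" and k: "k \<in> strips_up n l (b - 1)" and v: "v \<in> strips_down n k (a - 1)"
      by (cases y) auto
    have ge: "l 0 \<le> k 0" "v 0 \<le> k 0" using k v n by (auto simp: strips_up_def strips_down_def)
    have "k(0 := k 0 + 1) \<in> strips_up n l b"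
      using k ge n by (auto simp: strips_up_def sum_upd_0[OF n] simp del: fun_upd_apply) (auto simp: all_conj_distrib)
    moreover have "v \<in> strips_down n (k(0 := k 0 + 1)) a"
      using v ge n by (auto simp: strips_down_def sum_upd_0[OF n] simp del: fun_upd_apply) (auto simp: all_conj_distrib)
    ultimately show "(case y of (k, v) \<Rightarrow> (k(0 := k 0 + 1), v)) \<in> ?P b a - ?E" using ge by (simp add: y)
  qed auto
  then show ?thesis
    unfolding add_remove_gt using sum.subset_diff[OF sub fin, of "\<lambda>(k, v). gt_number n v m"] by simp
qed

lemma sum_connecting:
  assumes "finite S" and S: "\<And>v. connecting n l v b a \<noteq> {} \<Longrightarrow> v \<in> S"
  shows "(\<Sum>(k, v)\<in>{(k, v). k \<in> strips_up n l b \<and> v \<in> strips_down n k a \<and> k 0 = max (l 0) (v 0)}. f v)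
    = (\<Sum>v\<in>S. int (card (connecting n l v b a)) * f v)"
proof -
  have S': "v \<in> S" if "k \<in> strips_up n l b" "v \<in> strips_down n k a" "k 0 = max (l 0) (v 0)" for k v
    by (rule S) (use that in \<open>auto simp: connecting_def\<close>)
  have "(\<Sum>v\<in>S. int (card (connecting n l v b a)) * f v) = (\<Sum>v\<in>S. \<Sum>k\<in>connecting n l v b a. f v)"
    by simp
  also have "\<dots> = (\<Sum>(v, k)\<in>(SIGMA v:S. connecting n l v b a). f v)"
    using assms(1) by (intro sum.Sigma) (auto simp: connecting_def finite_up)
  also have "\<dots> = (\<Sum>(k, v)\<in>{(k, v). k \<in> strips_up n l b \<and> v \<in> strips_down n k a \<and> k 0 = max (l 0) (v 0)}. f v)"
    by (rule sum.reindex_bij_witness[where i = prod.swap and j = prod.swap])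
      (use S' in \<open>auto simp: connecting_def\<close>)
  finally show ?thesis ..
qed

lemma finite_connected: "finite {v. connecting n l v b a \<noteq> {}}"
proof (rule finite_subset)
  show "finite (\<Union>k\<in>strips_up n l b. strips_down n k a)" by (auto simp: finite_up finite_down)
qed (auto simp: connecting_def)

text \<open>Starting from the zero row, only the pair of (b, 0, ..., 0) and (b, 0, ..., 0, -a)
  survives in \<open>add_remove_diff\<close>, which becomes the product formula for the latter
  row.\<close>

lemma gt_hook:
  fixes a b :: nat
  assumes n: "2 \<le> n"
  shows "gt_number n (\<lambda>i. if i = 0 then int b else if i = n - 1 then - int a else 0) x
    = add_remove n (int b) (int a) (gt_number n (\<lambda>i. 0)) x - add_remove n (int b - 1) (int a - 1) (gt_number n (\<lambda>i. 0)) x"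
proof -
  let ?k = "\<lambda>i::nat. if i = 0 then int b else 0"
  let ?v = "\<lambda>i::nat. if i = 0 then int b else if i = n - 1 then - int a else 0"
  have sum_k: "(\<Sum>i<n. ?k i) = int b" using n by simp
  have sum_v: "(\<Sum>i<n. v i) = v 0 + v (n - 1)" if "\<And>i. i \<noteq> 0 \<Longrightarrow> i \<noteq> n - 1 \<Longrightarrow> i < n \<Longrightarrow> v i = 0" for v :: "nat \<Rightarrow> int"
  proof -
    have "(\<Sum>i<n. v i) = (\<Sum>i\<in>{0, n - 1}. v i)"
      using n that by (intro sum.mono_neutral_right) auto
    then show ?thesis using n by simp
  qed
  have "{(k, v). k \<in> strips_up n (\<lambda>i. 0) (int b) \<and> v \<in> strips_down n k (int a) \<and> k 0 = max 0 (v 0)} = {(?k, ?v)}" (is "?E = _")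
  proof (intro equalityI subsetI)
    fix y assume "y \<in> ?E"
    then obtain k v where y: "y = (k, v)" and k: "k \<in> strips_up n (\<lambda>i. 0) (int b)" and v: "v \<in> strips_down n k (int a)"
      and k0: "k 0 = max 0 (v 0)" by auto
    have k_0: "k i = 0" if "i \<noteq> 0" for i
      using k that by (cases i; cases "i < n") (auto simp: strips_up_def intro: antisym)
    then have "(\<Sum>i<n. k i) = k 0" using sum_v[of k] n by simp
    then have kk: "k = ?k" using k k_0 by (auto simp: strips_up_def fun_eq_iff)
    have v_0: "v i = 0" if "i \<noteq> 0" "i \<noteq> n - 1" for i
    proof (cases "i < n")
      case True
      then have "Suc i < n" using that by auto
      then have "k (Suc i) \<le> v i" "v i \<le> k i" using v by (auto simp: strips_down_def)
      then show ?thesis using that by (simp add: kk)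
    qed (use v in \<open>simp add: strips_down_def\<close>)
    have "k (Suc 0) \<le> v 0" using v n by (simp add: strips_down_def)
    then have v0: "v 0 = int b" using k0 by (simp add: kk)
    have "(\<Sum>i<n. v i) = v 0 + v (n - 1)" using v_0 by (intro sum_v) auto
    moreover have "(\<Sum>i<n. v i) = int b - int a" using v sum_k by (simp add: strips_down_def kk)
    ultimately have "v = ?v" using v_0 v0 by (auto simp: fun_eq_iff)
    then show "y \<in> {(?k, ?v)}" using y kk by simp
  next
    fix y assume "y \<in> {(?k, ?v)}"
    moreover have "(\<Sum>i<n. ?v i) = int b - int a" using n by (subst sum_v) auto
    ultimately show "y \<in> ?E" using n sum_k by (auto simp: strips_up_def strips_down_def)
  qed
  then show ?thesis using add_remove_diff[of n "int b" "int a" "\<lambda>i. 0" x] n by simp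
qed

text \<open>The zero row gives the unit of convolution, so the formula of \<open>gt_hook\<close>
  carries over to a product with \<open>l\<close>. The box \<open>X\<close> holds every contributing
  exponent: the first factor has exponents at least \<open>- a\<close>, and those of the second are
  nonnegative because \<open>l\<close> is.\<close>

lemma hook_convolution:
  fixes a b :: nat
  assumes n: "2 \<le> n" and l: "\<And>i. i < n \<Longrightarrow> 0 \<le> l i"
    and X: "X = {x. (\<forall>i<n. - int a \<le> x i \<and> x i \<le> m i) \<and> (\<forall>i\<ge>n. x i = 0)}"
  shows "(\<Sum>x\<in>X. gt_number n (\<lambda>i. if i = 0 then int b else if i = n - 1 then - int a else 0) x * gt_number n l (\<lambda>i. m i - x i))
    = add_remove n (int b) (int a) (gt_number n l) m - add_remove n (int b - 1) (int a - 1) (gt_number n l) m"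
proof -
  have finX: "finite X" unfolding X by (rule finite_box)
  have conv: "(\<Sum>x\<in>X. add_remove n b' a' (gt_number n (\<lambda>i. 0)) x * gt_number n l (\<lambda>i. m i - x i)) = add_remove n b' a' (gt_number n l) m"
    if a': "a' \<le> int a" for a' b'
  proof -
    have one: "(\<Sum>x\<in>X. gt_number n (\<lambda>i. 0) (\<lambda>i. x i - q i + p i) * gt_number n l (\<lambda>i. m i - x i)) = gt_number n l (\<lambda>i. m i - q i + p i)"
      if q: "q \<in> compositions n b'" and p: "p \<in> compositions n a'" for q p
    proof -
      let ?x = "\<lambda>i. q i - p i"
      have eq: "(\<forall>i<n. x i - q i + p i = 0) \<longleftrightarrow> x = ?x" if "x \<in> X" for x
      proof
        assume *: "\<forall>i<n. x i - q i + p i = 0"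
        show "x = ?x"
        proof
          fix i show "x i = ?x i" using * that q p by (cases "i < n") (auto simp: X compositions_def)
        qed
      qed auto
      have "(\<Sum>x\<in>X. gt_number n (\<lambda>i. 0) (\<lambda>i. x i - q i + p i) * gt_number n l (\<lambda>i. m i - x i))
          = (\<Sum>x\<in>X. if x = ?x then gt_number n l (\<lambda>i. m i - ?x i) else 0)"
        by (rule sum.cong) (auto simp: gt_zero eq)
      also have "\<dots> = gt_number n l (\<lambda>i. m i - ?x i)"
      \<comment> \<open>If the only candidate lies outside the box, the second factor would need a
        negative exponent, so the right-hand side is 0 too.\<close>
      proof (cases "?x \<in> X")
        case False
        have "p i \<le> a'" if "i < n" for i
          using p le_sum_int[of n p i] that by (auto simp: compositions_def)
        then have "- int a \<le> ?x i" if "i < n" for i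
          using q a' that by (fastforce simp: compositions_def)
        then obtain i where i: "i < n" "m i < ?x i"
          using False q p by (auto simp: X compositions_def not_le)
        have "gt_number n l (\<lambda>i. m i - ?x i) = 0"
          using gt_neq_0_imp_nonneg[of n l "\<lambda>i. m i - ?x i" i] i l by fastforce
        then show ?thesis using False finX by simp
      qed (use finX in simp)
      finally show ?thesis by (simp add: algebra_simps)
    qed
    have "(\<Sum>x\<in>X. add_remove n b' a' (gt_number n (\<lambda>i. 0)) x * gt_number n l (\<lambda>i. m i - x i))
       = (\<Sum>x\<in>X. \<Sum>q\<in>compositions n b'. \<Sum>p\<in>compositions n a'. gt_number n (\<lambda>i. 0) (\<lambda>i. x i - q i + p i) * gt_number n l (\<lambda>i. m i - x i))"
      by (simp add: add_remove_def sum_distrib_right)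
    also have "\<dots> = (\<Sum>q\<in>compositions n b'. \<Sum>p\<in>compositions n a'. \<Sum>x\<in>X. gt_number n (\<lambda>i. 0) (\<lambda>i. x i - q i + p i) * gt_number n l (\<lambda>i. m i - x i))"
      by (subst sum.swap, rule sum.cong[OF refl], rule sum.swap)
    also have "\<dots> = add_remove n b' a' (gt_number n l) m"
      unfolding add_remove_def by (intro sum.cong refl one)
    finally show ?thesis .
  qed
  show ?thesis
    using conv[of "int a" "int b"] conv[of "int a - 1" "int b - 1"]
    by (simp add: gt_hook[OF n] left_diff_distrib sum_subtractf)
qed

lemma connecting_iff:
  assumes "0 < n" "\<forall>i\<ge>n. v i = 0"
  shows "k \<in> connecting n l v b a \<longleftrightarrow> (\<forall>i<n. max (l i) (v i) \<le> k i) \<and>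
    (\<forall>i. Suc i < n \<longrightarrow> k (Suc i) \<le> min (l i) (v i)) \<and> (\<forall>i\<ge>n. k i = 0) \<and> k 0 = max (l 0) (v 0) \<and>
    (\<Sum>i<n. k i) = (\<Sum>i<n. l i) + b \<and> (\<Sum>i<n. k i) = (\<Sum>i<n. v i) + a"
  using assms by (auto simp: connecting_def strips_up_def strips_down_def)

text \<open>Ensures that every \<open>v\<close> that is reached becomes a partition when
  \<open>a\<close> is added, so that the expansion is one into Schur functions.\<close>

lemma connecting_nonempty:
  assumes k: "k \<in> connecting n l v b a" and n: "0 < n" and v: "\<forall>i\<ge>n. v i = 0" and l: "\<And>i. i < n \<Longrightarrow> 0 \<le> l i"
  shows "Suc i < n \<Longrightarrow> v (Suc i) \<le> v i" "- a \<le> v (n - 1)"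
proof -
  note k' = k[unfolded connecting_iff[OF n v]]
  show "v (Suc i) \<le> v i" if "Suc i < n"
  proof -
    have "v (Suc i) \<le> k (Suc i)" "k (Suc i) \<le> v i" using k' that by auto
    then show ?thesis by simp
  qed
  have "k (n - 1) - v (n - 1) \<le> (\<Sum>i<n. k i - v i)" using k' n by (intro le_sum_int) auto
  moreover have "l (n - 1) \<le> k (n - 1)" "0 \<le> l (n - 1)" using k' n l by auto
  ultimately show "- a \<le> v (n - 1)" using k' by (simp add: sum_subtractf)
qed

text \<open>Each point is translated by \<open>d\<close>, the difference of the lower ends of the
  intervals. Equal lengths align the upper ends, and the condition on \<open>k 0\<close> moves
  along. The change \<open>sum_d\<close> of the total, together with \<open>sum_w\<close>, exchanges
  the two sum conditions.\<close>

lemma card_connecting_eq: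
  assumes n: "0 < n" and v: "\<forall>i\<ge>n. v i = 0" and w: "\<forall>i\<ge>n. w i = 0"
    and len: "\<And>i. Suc i < n \<Longrightarrow> min (l i) (w i) - max (l (Suc i)) (w (Suc i)) = min (l i) (v i) - max (l (Suc i)) (v (Suc i))"
    and sum_w: "(\<Sum>i<n. w i) = 2 * (\<Sum>i<n. l i) - (\<Sum>i<n. v i)"
    and sum_min: "(\<Sum>i<n. min (l i) (w i)) = (\<Sum>i<n. l i) - (\<Sum>i<n. v i) + (\<Sum>i<n. min (l i) (v i))"
  shows "card (connecting n l v b a) = card (connecting n l w a b)"
proof -
  define d where "d i = (if i < n then max (l i) (w i) - max (l i) (v i) else 0)" for i
  have "(\<Sum>i<n. max (l i) (z i)) = (\<Sum>i<n. l i + z i - min (l i) (z i))" for z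
    by (rule sum.cong) auto
  then have smax: "(\<Sum>i<n. max (l i) (z i)) = (\<Sum>i<n. l i) + (\<Sum>i<n. z i) - (\<Sum>i<n. min (l i) (z i))" for z
    by (simp add: sum.distrib sum_subtractf)
  have sum_d: "(\<Sum>i<n. d i) = (\<Sum>i<n. l i) - (\<Sum>i<n. v i)"
    using sum_w sum_min by (simp add: d_def sum_subtractf smax)
  have bound: "k (Suc i) \<le> min (l i) (v i) \<longleftrightarrow> k (Suc i) + d (Suc i) \<le> min (l i) (w i)" if "Suc i < n" for k i
    using len[OF that] that by (simp add: d_def) linarith
  have "bij_betw (\<lambda>k i. k i + d i) (connecting n l v b a) (connecting n l w a b)"
  proof (rule bij_betw_byWitness[where f' = "\<lambda>k i. k i - d i"])
    show "(\<lambda>k i. k i + d i) ` connecting n l v b a \<subseteq> connecting n l w a b"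
    proof (rule image_subsetI)
      fix k assume k: "k \<in> connecting n l v b a"
      note k' = k[unfolded connecting_iff[OF n v]]
      have "max (l i) (w i) \<le> k i + d i" if "i < n" for i
        using k' that by (auto simp: d_def)
      moreover have "k (Suc i) + d (Suc i) \<le> min (l i) (w i)" if "Suc i < n" for i
        using k' that bound by blast
      ultimately show "(\<lambda>i. k i + d i) \<in> connecting n l w a b"
        unfolding connecting_iff[OF n w] using k' n sum_w by (simp add: sum.distrib sum_d) (simp add: d_def)
    qed
    show "(\<lambda>k i. k i - d i) ` connecting n l w a b \<subseteq> connecting n l v b a"
    proof (rule image_subsetI)
      fix k assume k: "k \<in> connecting n l w a b"
      note k' = k[unfolded connecting_iff[OF n w]]
      have "max (l i) (v i) \<le> k i - d i" if "i < n" for i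
        using k' that by (auto simp: d_def)
      moreover have "k (Suc i) - d (Suc i) \<le> min (l i) (v i)" if "Suc i < n" for i
        using k' that bound[of i "\<lambda>i. k i - d i"] by simp
      ultimately show "(\<lambda>i. k i - d i) \<in> connecting n l v b a"
        unfolding connecting_iff[OF n v] using k' n sum_w by (simp add: sum_subtractf sum_d) (simp add: d_def)
    qed
  qed auto
  then show ?thesis by (rule bij_betw_same_card)
qed

section \<open>Semistandard tableaux\<close>

definition tableaux :: "(nat \<Rightarrow> int) \<Rightarrow> (nat \<Rightarrow> nat) \<Rightarrow> (nat \<times> nat \<Rightarrow> nat) set" where
  "tableaux l c = {T \<in> ssyt l. \<forall>k. card {x \<in> diagram l. T x = k} = c k}"

lemma ParD:
  assumes "l \<in> Par"
  shows "i \<le> j \<Longrightarrow> l j \<le> l i" "0 \<le> l i" "finite {i. l i \<noteq> 0}" "l i = 0 \<Longrightarrow> i \<le> j \<Longrightarrow> l j = 0"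
proof -
  show 1: "l j \<le> l i" if "i \<le> j" for i j using assms that by (auto simp: Par_def antimono_def)
  show 2: "0 \<le> l i" for i using assms by (auto simp: Par_def)
  show "finite {i. l i \<noteq> 0}" using assms by (auto simp: Par_def)
  show "l i = 0 \<Longrightarrow> i \<le> j \<Longrightarrow> l j = 0" using 1[of i j] 2[of j] by simp
qed

lemma ParI:
  assumes "\<And>i. l (Suc i) \<le> l i" "\<And>i. i \<ge> n \<Longrightarrow> l i = 0"
  shows "l \<in> Par"
proof -
  have mono: "antimono l" using assms(1) by (simp add: antimono_iff_le_Suc)
  have "0 \<le> l i" for i
  proof (cases "i \<ge> n")
    case False
    then have "l n \<le> l i" using mono by (auto simp: antimono_def)
    then show ?thesis using assms(2)[of n] by simp
  qed (use assms(2) in simp)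
  moreover have "finite {i. l i \<noteq> 0}"
    by (rule finite_subset[of _ "{..<n}"]) (use assms(2) in \<open>auto simp: not_le[symmetric]\<close>)
  ultimately show ?thesis using mono by (simp add: Par_def)
qed

lemma card_diagram:
  assumes "l \<in> Par" "l n = 0"
  shows "int (card (diagram l)) = (\<Sum>i<n. l i)"
proof -
  have "diagram l = (SIGMA i:{..<n}. {..<nat (l i)})"
  proof -
    have "i < n" if "int j < l i" for i j
      using ParD(4)[OF assms, of i] that by (cases "n \<le> i") auto
    then show ?thesis by (auto simp: diagram_def)
  qed
  then show ?thesis using ParD(2)[OF assms(1)] by simp
qed

lemma diagram_inject:
  assumes "k \<in> Par" "l \<in> Par" "diagram k = diagram l"
  shows "k = l"
proof
  fix i
  have "int j < k i \<longleftrightarrow> int j < l i" for j using assms(3) by (auto simp: diagram_def)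
  from this[of "nat (k i)"] this[of "nat (l i)"] show "k i = l i"
    using ParD(2)[OF assms(1), of i] ParD(2)[OF assms(2), of i] by auto
qed

lemma ssyt_ge_row:
  assumes "T \<in> ssyt l" "l \<in> Par" "(i, j) \<in> diagram l"
  shows "i \<le> T (i, j)"
  using assms(3)
proof (induction i)
  case (Suc i)
  have "l (Suc i) \<le> l i" using ParD(1)[OF assms(2)] by simp
  then have "(i, j) \<in> diagram l" using Suc.prems by (auto simp: diagram_def)
  then have "T (i, j) < T (Suc i, j)" "i \<le> T (i, j)"
    using assms(1) Suc by (auto simp: ssyt_def)
  then show ?case by simp
qed simp

lemma tableaux_content:
  assumes "T \<in> tableaux l c" "l \<in> Par" "x \<in> diagram l"
  shows "c (T x) \<noteq> 0"
proof -
  have "card {y \<in> diagram l. T y = T x} > 0"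
    using assms(3) finite_diagram[OF assms(2)] by (subst card_gt_0_iff) fastforce
  then show ?thesis using assms(1) by (auto simp: tableaux_def)
qed

lemma finite_tableaux:
  assumes "l \<in> Par" "\<forall>k\<ge>n. c k = 0"
  shows "finite (tableaux l c)"
proof (rule finite_subset)
  show "finite (diagram l \<rightarrow>\<^sub>E {..<n})"
    by (intro finite_PiE finite_diagram assms) auto
  show "tableaux l c \<subseteq> diagram l \<rightarrow>\<^sub>E {..<n}"
  proof
    fix T assume T: "T \<in> tableaux l c"
    have "T x < n" if "x \<in> diagram l" for x
      using tableaux_content[OF T assms(1) that] assms(2) by (meson not_le)
    then show "T \<in> diagram l \<rightarrow>\<^sub>E {..<n}" using T by (auto simp: tableaux_def ssyt_def PiE_iff)
  qed
qed

lemma down_closed_nat: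
  assumes "finite (S :: nat set)" "\<And>j j'. j \<in> S \<Longrightarrow> j' < j \<Longrightarrow> j' \<in> S"
  shows "S = {..<card S}"
proof (cases "S = {}")
  case False
  then have "Max S \<in> S" using assms(1) by simp
  then have "S = {..Max S}" using assms by (auto simp: order_le_less dest: Max_ge)
  then show ?thesis by (metis card_atMost lessThan_Suc_atMost)
qed simp

lemma ilace_Par:
  assumes l: "l \<in> Par" and k: "k \<in> interlacing n l c"
  shows "k \<in> Par"
proof (rule ParI[where n = n])
  fix i
  show "k i = 0" if "n \<le> i" for i using k that by (simp add: interlacing_def)
  have nn: "0 \<le> k i" using ilace_nonneg(1)[OF _ k] ParD(2)[OF l] k by (cases "i < n") (auto simp: interlacing_def)
  consider "Suc i < n" | "n \<le> Suc i" by linarith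
  then show "k (Suc i) \<le> k i"
  proof cases
    case 1
    then have "k (Suc i) \<le> l (Suc i)" "l (Suc i) \<le> k i" using k by (auto simp: interlacing_def)
    then show ?thesis by simp
  qed (use k nn in \<open>simp add: interlacing_def\<close>)
qed

text \<open>Deleting the largest letter \<open>n\<close> leaves a diagram. Column strictness allows
  at most one \<open>n\<close> per column, which is the interlacing condition.\<close>

lemma tableaux_shape:
  assumes l: "l \<in> Par" "l (Suc n) = 0" and c: "\<forall>k\<ge>Suc n. c k = 0" and T: "T \<in> tableaux l c"
  shows "\<exists>k\<in>interlacing n l (int (c n)). {x \<in> diagram l. T x < n} = diagram k"
proof -
  define S where "S i = {j. (i, j) \<in> diagram l \<and> T (i, j) < n}" for i
  define k where "k i = int (card (S i))" for i
  have ss: "T \<in> ssyt l" using T by (simp add: tableaux_def)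
  have Tn: "T x \<le> n" if "x \<in> diagram l" for x
    using tableaux_content[OF T l(1) that] c by (metis not_less_eq_eq)
  have sub: "S i \<subseteq> {..<nat (l i)}" for i by (auto simp: S_def diagram_def)
  then have finS: "finite (S i)" for i by (rule finite_subset) simp
  have S: "S i = {..<card (S i)}" for i
  proof (rule down_closed_nat[OF finS])
    fix j j' assume j: "j \<in> S i" "j' < j"
    then have "(i, j') \<in> diagram l" by (auto simp: S_def diagram_def)
    moreover from this have "T (i, j') \<le> T (i, j)" using ss j by (auto simp: S_def ssyt_def)
    ultimately show "j' \<in> S i" using j by (auto simp: S_def)
  qed
  have dk: "{x \<in> diagram l. T x < n} = diagram k"
  proof -
    have "(i, j) \<in> {x \<in> diagram l. T x < n} \<longleftrightarrow> j < card (S i)" for i j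
      using S[of i] by (auto simp: S_def)
    then show ?thesis by (auto simp: k_def diagram_def)
  qed
  have k_le: "k i \<le> l i" for i
    using card_mono[OF _ sub[of i]] ParD(2)[OF l(1), of i] by (simp add: k_def)
  have k_ge: "l (Suc i) \<le> k i" for i
  proof -
    have "{..<nat (l (Suc i))} \<subseteq> S i"
    proof
      fix j assume "j \<in> {..<nat (l (Suc i))}"
      then have j: "(Suc i, j) \<in> diagram l" by (auto simp: diagram_def)
      have "l (Suc i) \<le> l i" using ParD(1)[OF l(1)] by simp
      with j have j': "(i, j) \<in> diagram l" by (auto simp: diagram_def)
      have "T (i, j) < T (Suc i, j)" using ss j j' by (auto simp: ssyt_def)
      then show "j \<in> S i" using Tn[OF j] j' by (auto simp: S_def)
    qed
    from card_mono[OF finS this] show ?thesis by (simp add: k_def)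
  qed
  \<comment> \<open>Entries in row \<open>i\<close> are at least \<open>i\<close>, so from row
    \<open>n\<close> on no letter is below \<open>n\<close>.\<close>
  have k_0: "k i = 0" if "n \<le> i" for i
  proof -
    have "S i = {}" using ssyt_ge_row[OF ss l(1), of i] that by (force simp: S_def)
    then show ?thesis by (simp add: k_def)
  qed
  have "k (Suc i) \<le> k i" for i using k_le[of "Suc i"] k_ge[of i] by simp
  then have kP: "k \<in> Par" using k_0 by (rule ParI)
  have "c n = card {x \<in> diagram l. T x = n}" using T by (simp add: tableaux_def)
  also have "{x \<in> diagram l. T x = n} = diagram l - {x \<in> diagram l. T x < n}"
    using Tn by (auto simp: order.order_iff_strict)
  also have "card \<dots> = card (diagram l) - card (diagram k)"
    using dk finite_diagram[OF kP] by (subst card_Diff_subset) auto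
  finally have "int (c n) = int (card (diagram l)) - int (card (diagram k))"
    using card_mono[OF finite_diagram[OF l(1)], of "diagram k"] dk[symmetric] by (auto simp: of_nat_diff)
  then have "int (c n) = (\<Sum>i<Suc n. l i) - (\<Sum>i<n. k i)"
    using card_diagram[OF l] card_diagram[OF kP k_0[of n]] by simp
  then have "k \<in> interlacing n l (int (c n))" using k_le k_ge k_0 by (simp add: interlacing_def)
  then show ?thesis using dk by blast
qed

text \<open>The inverse fills the strip between \<open>k\<close> and \<open>l\<close> with the
  letter \<open>n\<close>; the sum condition of interlacing says that the strip has
  \<open>c n\<close> cells.\<close>

lemma tableaux_branching:
  assumes l: "l \<in> Par" "l (Suc n) = 0" and c: "\<forall>k\<ge>Suc n. c k = 0" and k: "k \<in> interlacing n l (int (c n))"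
  shows "bij_betw (\<lambda>T. restrict T (diagram k)) {T \<in> tableaux l c. {x \<in> diagram l. T x < n} = diagram k}
    (tableaux k (c(n := 0)))"
proof -
  let ?B = "{T \<in> tableaux l c. {x \<in> diagram l. T x < n} = diagram k}"
  let ?f = "\<lambda>T x. if x \<in> diagram k then T x else if x \<in> diagram l then n else undefined"
  have kP: "k \<in> Par" by (rule ilace_Par[OF l(1) k])
  have k_0: "k i = 0" if "n \<le> i" for i using k that by (simp add: interlacing_def)
  have k_le: "k i \<le> l i" for i
    using k ParD(2)[OF l(1), of i] by (cases "i < n") (auto simp: interlacing_def)
  then have sub: "diagram k \<subseteq> diagram l" by (auto simp: diagram_def intro: less_le_trans)
  have k_ge: "l (Suc i) \<le> k i" for i
  proof (cases "i < n")
    case False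
    then show ?thesis using ParD(4)[OF l, of "Suc i"] ParD(2)[OF kP, of i] by simp
  qed (use k in \<open>simp add: interlacing_def\<close>)
  have card_diff: "card (diagram l - diagram k) = c n"
  proof -
    have "int (card (diagram l)) - int (card (diagram k)) = int (c n)"
      using card_diagram[OF l] card_diagram[OF kP k_0[of n]] k by (simp add: interlacing_def)
    then show ?thesis using finite_diagram[OF kP] sub by (simp add: card_Diff_subset)
  qed
  show ?thesis
  proof (rule bij_betw_byWitness[where f' = ?f])
    show "\<forall>T\<in>?B. ?f (restrict T (diagram k)) = T"
    proof
      fix T assume T: "T \<in> ?B"
      have "T x = n" if "x \<in> diagram l" "x \<notin> diagram k" for x
      proof -
        have "T x \<noteq> Suc m" if "n \<le> m" for m
          using tableaux_content[of T l c x] T l c \<open>x \<in> diagram l\<close> that by auto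
        moreover have "n \<le> T x" using T that by force
        ultimately show ?thesis by (metis Suc_le_D le_neq_implies_less less_Suc_eq_le less_eq_Suc_le)
      qed
      then show "?f (restrict T (diagram k)) = T"
        using T by (auto simp: fun_eq_iff tableaux_def ssyt_def extensional_def)
    qed
    show "\<forall>T\<in>tableaux k (c(n := 0)). restrict (?f T) (diagram k) = T"
      by (auto simp: fun_eq_iff tableaux_def ssyt_def extensional_def)
    show "(\<lambda>T. restrict T (diagram k)) ` ?B \<subseteq> tableaux k (c(n := 0))"
    proof (rule image_subsetI)
      fix T assume T: "T \<in> ?B"
      have "card {x \<in> diagram k. restrict T (diagram k) x = j} = (c(n := 0)) j" for j
      proof (cases "j < n")
        case True
        then have "{x \<in> diagram k. restrict T (diagram k) x = j} = {x \<in> diagram l. T x = j}"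
          using T by auto
        then show ?thesis using T True by (simp add: tableaux_def)
      next
        case False
        then have empty: "{x \<in> diagram k. restrict T (diagram k) x = j} = {}" using T by auto
        have "(c(n := 0)) j = 0" using c False by simp
        then show ?thesis unfolding empty by simp
      qed
      moreover have "restrict T (diagram k) \<in> ssyt k"
        using T sub unfolding tableaux_def ssyt_def by (auto simp: subset_iff)
      ultimately show "restrict T (diagram k) \<in> tableaux k (c(n := 0))" by (simp add: tableaux_def)
    qed
    show "?f ` tableaux k (c(n := 0)) \<subseteq> ?B"
    proof (rule image_subsetI)
      fix T assume T: "T \<in> tableaux k (c(n := 0))"
      then have ss: "T \<in> ssyt k" by (simp add: tableaux_def)
      have Tn: "T x < n" if "x \<in> diagram k" for x
        using tableaux_content[OF T kP that] c by (auto split: if_splits) (metis not_less_eq_eq le_less_Suc_eq less_or_eq_imp_le not_le)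
      have lt: "{x \<in> diagram l. ?f T x < n} = diagram k" using sub Tn by auto
      have "card {x \<in> diagram l. ?f T x = j} = c j" for j
      proof -
        consider "j < n" | "j = n" | "Suc n \<le> j" by linarith
        then show ?thesis
        proof cases
          case 1
          then have "{x \<in> diagram l. ?f T x = j} = {x \<in> diagram k. T x = j}" using sub by auto
          then show ?thesis using T 1 by (simp add: tableaux_def)
        next
          case 2
          then have "{x \<in> diagram l. ?f T x = j} = diagram l - diagram k" using Tn by force
          then show ?thesis using card_diff 2 by simp
        next
          case 3
          then have empty: "{x \<in> diagram l. ?f T x = j} = {}" using Tn by force
          show ?thesis unfolding empty using c 3 by simp
        qed
      qed
      moreover have "?f T \<in> ssyt l"
      proof -
        have "?f T (i, j) \<le> ?f T (i, j')" if "(i, j) \<in> diagram l" "(i, j') \<in> diagram l" "j < j'" for i j j'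
        proof (cases "(i, j') \<in> diagram k")
          case True
          then have "(i, j) \<in> diagram k" using that by (auto simp: diagram_def)
          then show ?thesis using True ss that by (auto simp: ssyt_def)
        qed (use that Tn[of "(i, j)"] in auto)
        \<comment> \<open>By interlacing the upper of two cells in a column lies in
          \<open>k\<close>, so two cells filled with \<open>n\<close> never share a column.\<close>
        moreover have "?f T (i, j) < ?f T (i', j)" if ij: "(i, j) \<in> diagram l" "(i', j) \<in> diagram l" "i < i'" for i i' j
        proof -
          have "l i' \<le> k i" using ParD(1)[OF l(1), of "Suc i" i'] k_ge[of i] ij by simp
          then have kij: "(i, j) \<in> diagram k" using ij by (auto simp: diagram_def)
          then show ?thesis using ij ss Tn[OF kij] by (auto simp: ssyt_def)
        qed
        moreover have "?f T \<in> extensional (diagram l)" using sub by (auto simp: extensional_def)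
        ultimately show ?thesis unfolding ssyt_def by blast
      qed
      ultimately show "?f T \<in> ?B" using lt by (simp add: tableaux_def)
    qed
  qed
qed

text \<open>Stripping off letters from the largest down turns a tableau into a pattern. If
  \<open>l n\<close> is nonzero, the first column has more than \<open>n\<close> cells and cannot
  increase strictly within \<open>n\<close> letters.\<close>

lemma card_tableaux:
  assumes "l \<in> Par" "\<forall>k\<ge>n. c k = 0"
  shows "int (card (tableaux l c)) = (if l n = 0 then gt_number n l (\<lambda>i. int (c i)) else 0)"
  using assms
proof (induction n arbitrary: l c)
  case 0
  show ?case
  proof (cases "l 0 = 0")
    case True
    then have "l i = 0" for i using ParD(4)[OF 0(1)] by blast
    then have "diagram l = {}" by (auto simp: diagram_def)
    then have "tableaux l c = {\<lambda>_. undefined}" using 0(2) by (auto simp: tableaux_def ssyt_def)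
    then show ?thesis using True by simp
  next
    case False
    then have "(0, 0) \<in> diagram l" using ParD(2)[OF 0(1), of 0] by (simp add: diagram_def)
    then have "tableaux l c = {}" using tableaux_content[OF _ 0(1)] 0(2) by blast
    then show ?thesis using False by simp
  qed
next
  case (Suc n)
  note l = Suc.prems(1)
  show ?case
  proof (cases "l (Suc n) = 0")
    case False
    then have d: "(Suc n, 0) \<in> diagram l" using ParD(2)[OF l, of "Suc n"] by (simp add: diagram_def)
    have "Suc n \<le> T (Suc n, 0) \<and> c (T (Suc n, 0)) \<noteq> 0" if "T \<in> tableaux l c" for T
      using ssyt_ge_row[OF _ l d, of T] tableaux_content[OF that l d] that by (auto simp: tableaux_def)
    then have "tableaux l c = {}" using Suc.prems(2) by blast
    then show ?thesis using False by simp
  next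
    case True
    let ?I = "interlacing n l (int (c n))"
    let ?B = "\<lambda>k. {T \<in> tableaux l c. {x \<in> diagram l. T x < n} = diagram k}"
    have fin: "finite (tableaux l c)" by (rule finite_tableaux[OF l Suc.prems(2)])
    have "tableaux l c = (\<Union>k\<in>?I. ?B k)"
      using tableaux_shape[OF l True Suc.prems(2)] by blast
    also have "card \<dots> = (\<Sum>k\<in>?I. card (?B k))"
    proof (rule card_UN_disjoint)
      show "\<forall>i\<in>?I. \<forall>j\<in>?I. i \<noteq> j \<longrightarrow> ?B i \<inter> ?B j = {}"
        using diagram_inject ilace_Par[OF l] by blast
    qed (use fin finite_ilace in auto)
    also have "\<dots> = (\<Sum>k\<in>?I. card (tableaux k (c(n := 0))))"
      by (intro sum.cong refl bij_betw_same_card[OF tableaux_branching[OF l True Suc.prems(2)]])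
    also have "int \<dots> = (\<Sum>k\<in>?I. gt_number n k (\<lambda>i. int (c i)))"
      unfolding of_nat_sum
    proof (rule sum.cong[OF refl])
      fix k assume k: "k \<in> ?I"
      have "\<forall>j\<ge>n. (c(n := 0)) j = 0" using Suc.prems(2) by (metis fun_upd_apply le_neq_implies_less Suc_leI)
      then have "int (card (tableaux k (c(n := 0)))) = (if k n = 0 then gt_number n k (\<lambda>i. int ((c(n := 0)) i)) else 0)"
        by (rule Suc.IH[OF ilace_Par[OF l k]])
      also have "\<dots> = gt_number n k (\<lambda>i. int ((c(n := 0)) i))" using k by (simp add: interlacing_def)
      also have "\<dots> = gt_number n k (\<lambda>i. int (c i))" by (rule gt_cong) simp
      finally show "int (card (tableaux k (c(n := 0)))) = gt_number n k (\<lambda>i. int (c i))" .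
    qed
    finally show ?thesis using True by simp
  qed
qed

lemma schur_eq_gt:
  assumes "l \<in> Par" "\<forall>k\<ge>n. Poly_Mapping.lookup m k = 0"
  shows "schur l m = (if l n = 0 then gt_number n l (\<lambda>i. int (Poly_Mapping.lookup m i)) else 0)"
  using card_tableaux[OF assms] by (simp add: schur_def tableaux_def)

section \<open>Schur expansions\<close>

lemma mtimes_assoc: "mtimes (mtimes f g) h = mtimes f (mtimes g h)"
proof
  fix m
  let ?D = "\<lambda>m. {(p, q). p + q = (m :: monom)}"
  have "mtimes (mtimes f g) h m = (\<Sum>((r, s), (p, q))\<in>(SIGMA x:?D m. ?D (fst x)). f p * g q * h s)"
    by (simp add: mtimes_def case_prod_unfold sum_distrib_right sum.Sigma finite_decompositions[unfolded case_prod_unfold])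
  also have "\<dots> = (\<Sum>((p, t), (q, s))\<in>(SIGMA x:?D m. ?D (snd x)). f p * g q * h s)"
    by (rule sum.reindex_bij_witness[where j = "\<lambda>((r, s), (p, q)). ((p, q + s), (q, s))"
          and i = "\<lambda>((p, t), (q, s)). ((p + q, s), (p, q))"]) (auto simp: add.assoc)
  also have "\<dots> = mtimes f (mtimes g h) m"
    by (simp add: mtimes_def case_prod_unfold sum_distrib_left sum.Sigma mult.assoc finite_decompositions[unfolded case_prod_unfold])
  finally show "mtimes (mtimes f g) h m = mtimes f (mtimes g h) m" .
qed

lemma mtimes_sum_left: "mtimes (\<lambda>m. \<Sum>i\<in>A. c i * F i m) g m = (\<Sum>i\<in>A. c i * mtimes (F i) g m)"
proof -
  have "mtimes (\<lambda>m. \<Sum>i\<in>A. c i * F i m) g m = (\<Sum>x\<in>{(p, q). p + q = m}. \<Sum>i\<in>A. c i * (F i (fst x) * g (snd x)))"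
    by (simp add: mtimes_def case_prod_unfold sum_distrib_right mult.assoc)
  also have "\<dots> = (\<Sum>i\<in>A. \<Sum>x\<in>{(p, q). p + q = m}. c i * (F i (fst x) * g (snd x)))"
    by (rule sum.swap)
  finally show ?thesis by (simp add: mtimes_def case_prod_unfold sum_distrib_left)
qed

lemma mtimes_sum_right: "mtimes g (\<lambda>m. \<Sum>i\<in>A. c i * F i m) m = (\<Sum>i\<in>A. c i * mtimes g (F i) m)"
proof -
  have "mtimes g (\<lambda>m. \<Sum>i\<in>A. c i * F i m) m = (\<Sum>x\<in>{(p, q). p + q = m}. \<Sum>i\<in>A. c i * (g (fst x) * F i (snd x)))"
    by (simp add: mtimes_def case_prod_unfold sum_distrib_left mult.left_commute)
  also have "\<dots> = (\<Sum>i\<in>A. \<Sum>x\<in>{(p, q). p + q = m}. c i * (g (fst x) * F i (snd x)))"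
    by (rule sum.swap)
  finally show ?thesis by (simp add: mtimes_def case_prod_unfold sum_distrib_left)
qed

section \<open>Products of series in finitely many variables and the Pieri rule for Schur
  functions\<close>

definition monom_of :: "(nat \<Rightarrow> int) \<Rightarrow> monom" where
  "monom_of x = Abs_poly_mapping (\<lambda>i. nat (x i))"

lemma lookup_mon:
  assumes "\<forall>i\<ge>n. x i = 0"
  shows "Poly_Mapping.lookup (monom_of x) i = nat (x i)"
proof -
  have "{i. nat (x i) \<noteq> 0} \<subseteq> {..<n}" using assms by (auto simp: not_le[symmetric])
  then have "finite {i. nat (x i) \<noteq> 0}" by (rule finite_subset) simp
  then show ?thesis by (simp add: monom_of_def)
qed

lemma ex_bound_keys: "\<exists>n\<ge>n0. \<forall>k\<ge>n. Poly_Mapping.lookup (m :: monom) k = 0"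
proof -
  obtain b where b: "\<forall>k\<in>Poly_Mapping.keys m. k < b"
    using finite_nat_set_iff_bounded[of "Poly_Mapping.keys m"] by auto
  have "\<forall>k\<ge>max n0 b. Poly_Mapping.lookup m k = 0"
    using b by (auto simp: in_keys_iff dest: leD)
  then show ?thesis by (meson max.cobounded1)
qed

text \<open>Factors of a monomial involve only its own variables, so the coefficient of a product is
  a sum over the integer points of a finite box.\<close>

lemma mtimes_box:
  assumes m: "\<forall>k\<ge>n. Poly_Mapping.lookup m k = 0"
  shows "mtimes f g m = (\<Sum>x\<in>{x. (\<forall>i<n. 0 \<le> x i \<and> x i \<le> int (Poly_Mapping.lookup m i)) \<and> (\<forall>i\<ge>n. x i = 0)}.
     f (monom_of x) * g (monom_of (\<lambda>i. int (Poly_Mapping.lookup m i) - x i)))"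
  unfolding mtimes_def
proof (rule sum.reindex_bij_witness[where j = "\<lambda>(p, q) i. int (Poly_Mapping.lookup p i)"
      and i = "\<lambda>x. (monom_of x, monom_of (\<lambda>i. int (Poly_Mapping.lookup m i) - x i))"])
  have mon_lookup: "monom_of (\<lambda>i. int (Poly_Mapping.lookup p i)) = p" for p
    by (simp add: monom_of_def)
  fix y :: "monom \<times> monom" assume "y \<in> {(p, q). p + q = m}"
  then obtain p q where y: "y = (p, q)" and pq: "m = p + q" by auto
  have q: "(\<lambda>i. int (Poly_Mapping.lookup m i) - int (Poly_Mapping.lookup p i)) = (\<lambda>i. int (Poly_Mapping.lookup q i))"
    by (simp add: pq lookup_add)
  show "(monom_of ((\<lambda>(p, q) i. int (Poly_Mapping.lookup p i)) y),
      monom_of (\<lambda>i. int (Poly_Mapping.lookup m i) - (\<lambda>(p, q) i. int (Poly_Mapping.lookup p i)) y i)) = y"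
    by (simp add: y q mon_lookup)
  show "f (monom_of ((\<lambda>(p, q) i. int (Poly_Mapping.lookup p i)) y)) *
      g (monom_of (\<lambda>i. int (Poly_Mapping.lookup m i) - (\<lambda>(p, q) i. int (Poly_Mapping.lookup p i)) y i)) = (case y of (p, q) \<Rightarrow> f p * g q)"
    by (simp add: y q mon_lookup)
  have "Poly_Mapping.lookup p k = 0" if "n \<le> k" for k using m that by (simp add: pq lookup_add)
  then show "(\<lambda>(p, q) i. int (Poly_Mapping.lookup p i)) y \<in> {x. (\<forall>i<n. 0 \<le> x i \<and> x i \<le> int (Poly_Mapping.lookup m i)) \<and> (\<forall>i\<ge>n. x i = 0)}"
    by (simp add: y pq lookup_add)
next
  fix x assume x: "x \<in> {x. (\<forall>i<n. 0 \<le> x i \<and> x i \<le> int (Poly_Mapping.lookup m i)) \<and> (\<forall>i\<ge>n. x i = 0)}"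
  have 1: "Poly_Mapping.lookup (monom_of x) i = nat (x i)" for i using x by (intro lookup_mon) auto
  have 2: "Poly_Mapping.lookup (monom_of (\<lambda>i. int (Poly_Mapping.lookup m i) - x i)) i = nat (int (Poly_Mapping.lookup m i) - x i)" for i
    using x m by (intro lookup_mon[of n]) auto
  have nn: "0 \<le> x i \<and> x i \<le> int (Poly_Mapping.lookup m i)" for i using x m by (cases "i < n") auto
  show "(monom_of x, monom_of (\<lambda>i. int (Poly_Mapping.lookup m i) - x i)) \<in> {(p, q). p + q = m}"
    using nn by (auto intro!: poly_mapping_eqI simp: lookup_add 1 2 nat_add_distrib[symmetric])
  show "(\<lambda>(p, q) i. int (Poly_Mapping.lookup p i)) (monom_of x, monom_of (\<lambda>i. int (Poly_Mapping.lookup m i) - x i)) = x"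
    using nn by (auto simp: 1)
qed

lemma schur_mon:
  assumes "l \<in> Par" "l n = 0" "\<forall>i\<ge>n. x i = 0" "\<And>i. i < n \<Longrightarrow> 0 \<le> x i"
  shows "schur l (monom_of x) = gt_number n l x"
proof -
  have "schur l (monom_of x) = gt_number n l (\<lambda>i. int (Poly_Mapping.lookup (monom_of x) i))"
    using assms lookup_mon[OF assms(3)] by (subst schur_eq_gt[where n = n]) auto
  also have "\<dots> = gt_number n l x"
    by (rule gt_cong) (use assms in \<open>simp add: lookup_mon[OF assms(3)]\<close>)
  finally show ?thesis .
qed

text \<open>This is the complete homogeneous symmetric function h_b.\<close>

definition homogeneous :: "nat \<Rightarrow> mseries" where
  "homogeneous b m = (if (\<Sum>k\<in>Poly_Mapping.keys m. Poly_Mapping.lookup m k) = b then 1 else 0)"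

lemma homogeneous_mon:
  assumes "\<forall>i\<ge>n. x i = 0" "\<And>i. i < n \<Longrightarrow> 0 \<le> x i"
  shows "homogeneous b (monom_of x) = (if (\<Sum>i<n. x i) = int b then 1 else 0)"
proof -
  note l = lookup_mon[OF assms(1)]
  have "Poly_Mapping.keys (monom_of x) \<subseteq> {..<n}"
    using assms by (auto simp: in_keys_iff l not_le[symmetric])
  then have "(\<Sum>k\<in>Poly_Mapping.keys (monom_of x). Poly_Mapping.lookup (monom_of x) k) = (\<Sum>k<n. Poly_Mapping.lookup (monom_of x) k)"
    by (intro sum.mono_neutral_left) (auto simp: in_keys_iff)
  also have "int \<dots> = (\<Sum>i<n. x i)" using assms by (simp add: l)
  finally show ?thesis unfolding homogeneous_def by (metis of_nat_eq_iff)
qed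

lemma up_Par:
  assumes l: "l \<in> Par" and k: "k \<in> strips_up n l b"
  shows "k \<in> Par"
proof (rule ParI[where n = n])
  fix i
  show "k i = 0" if "n \<le> i" for i using k that by (simp add: strips_up_def)
  have "0 \<le> k i" using k ParD(2)[OF l, of i] by (cases "i < n") (auto simp: strips_up_def)
  moreover have "k (Suc i) \<le> k i" if "Suc i < n"
  proof -
    have "k (Suc i) \<le> l i" "l i \<le> k i" using k that by (auto simp: strips_up_def)
    then show ?thesis by simp
  qed
  ultimately show "k (Suc i) \<le> k i" using k by (cases "Suc i < n") (auto simp: strips_up_def)
qed

text \<open>A horizontal strip adds at most one new row. In \<open>pieri_schur\<close> the number
  \<open>N\<close> of variables depends on the monomial, while the index set of the expansion must
  not.\<close>

lemma up_stable:
  assumes l: "l \<in> Par" "l n = 0" and N: "Suc n \<le> N"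
  shows "strips_up N l b = strips_up (Suc n) l b"
proof -
  have l0: "l i = 0" if "n \<le> i" for i using ParD(4)[OF l that] .
  have sum: "(\<Sum>i<N. k i) = (\<Sum>i<Suc n. k i)" if "\<forall>i\<ge>Suc n. k i = 0" for k :: "nat \<Rightarrow> int"
    using that N by (intro sum.mono_neutral_right) auto
  have "k i = 0" if k: "k \<in> strips_up N l b" and i: "Suc n \<le> i" for k i
  proof (cases "i < N")
    case True
    obtain j where j: "i = Suc j" using i by (cases i) auto
    have "l i \<le> k i" "k i \<le> l j" using k True j by (auto simp: strips_up_def)
    then show ?thesis using l0[of i] l0[of j] i j by simp
  qed (use k in \<open>simp add: strips_up_def\<close>)
  then have A: "k \<in> strips_up N l b \<Longrightarrow> \<forall>i\<ge>Suc n. k i = 0" for k by blast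
  have B: "k \<in> strips_up (Suc n) l b \<Longrightarrow> \<forall>i\<ge>Suc n. k i = 0" for k by (simp add: strips_up_def)
  have "k \<in> strips_up N l b \<longleftrightarrow> k \<in> strips_up (Suc n) l b" if k: "\<forall>i\<ge>Suc n. k i = 0" for k
  proof -
    have 1: "l i \<le> k i" if "\<not> i < Suc n" for i using k l0 that by simp
    have 2: "k (Suc i) \<le> l i" if "\<not> Suc i < Suc n" for i using k ParD(2)[OF l(1), of i] that by simp
    have "(\<forall>i<N. l i \<le> k i) \<longleftrightarrow> (\<forall>i<Suc n. l i \<le> k i)"
      using N 1 by (meson less_le_trans)
    moreover have "(\<forall>i. Suc i < N \<longrightarrow> k (Suc i) \<le> l i) \<longleftrightarrow> (\<forall>i. Suc i < Suc n \<longrightarrow> k (Suc i) \<le> l i)"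
      using N 2 by (meson less_le_trans)
    moreover have "(\<forall>i\<ge>N. k i = 0) \<longleftrightarrow> (\<forall>i\<ge>Suc n. k i = 0)" using k N by auto
    ultimately show ?thesis
      unfolding strips_up_def mem_Collect_eq using sum[OF k] sum[of l] l0 by simp
  qed
  then show ?thesis using A B by blast
qed

lemma pieri_schur:
  assumes l: "l \<in> Par" "l n = 0"
  shows "mtimes (homogeneous b) (schur l) = (\<lambda>m. \<Sum>k\<in>strips_up (Suc n) l (int b). schur k m)"
proof
  fix m :: monom
  obtain N where N: "N \<ge> Suc n" and m: "\<forall>k\<ge>N. Poly_Mapping.lookup m k = 0" using ex_bound_keys[of "Suc n" m] by blast
  have lN: "l N = 0" using ParD(4)[OF l] N by simp
  let ?m = "\<lambda>i. int (Poly_Mapping.lookup m i)"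
  let ?X = "{x. (\<forall>i<N. 0 \<le> x i \<and> x i \<le> ?m i) \<and> (\<forall>i\<ge>N. x i = 0)}"
  have "mtimes (homogeneous b) (schur l) m = (\<Sum>x\<in>?X. if (\<Sum>i<N. x i) = int b then gt_number N l (\<lambda>i. ?m i - x i) else 0)"
    unfolding mtimes_box[OF m]
  proof (rule sum.cong[OF refl])
    fix x assume x: "x \<in> ?X"
    then have "schur l (monom_of (\<lambda>i. ?m i - x i)) = gt_number N l (\<lambda>i. ?m i - x i)"
      using m by (intro schur_mon l lN) auto
    moreover have "homogeneous b (monom_of x) = (if (\<Sum>i<N. x i) = int b then 1 else 0)"
      using x by (intro homogeneous_mon) auto
    ultimately show "homogeneous b (monom_of x) * schur l (monom_of (\<lambda>i. ?m i - x i)) = (if (\<Sum>i<N. x i) = int b then gt_number N l (\<lambda>i. ?m i - x i) else 0)"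
      by simp
  qed
  also have "\<dots> = (\<Sum>x\<in>{x \<in> ?X. (\<Sum>i<N. x i) = int b}. gt_number N l (\<lambda>i. ?m i - x i))"
    using finite_box[of N "\<lambda>i. 0" ?m] by (simp only: sum.inter_filter)
  also have "\<dots> = (\<Sum>x\<in>compositions N (int b). gt_number N l (\<lambda>i. ?m i - x i))"
  proof (rule sum.mono_neutral_left[OF finite_comps])
    show "\<forall>x\<in>compositions N (int b) - {x \<in> ?X. (\<Sum>i<N. x i) = int b}. gt_number N l (\<lambda>i. ?m i - x i) = 0"
    proof
      fix x assume "x \<in> compositions N (int b) - {x \<in> ?X. (\<Sum>i<N. x i) = int b}"
      then obtain i where i: "i < N" "?m i < x i" by (auto simp: compositions_def not_le)
      then show "gt_number N l (\<lambda>i. ?m i - x i) = 0"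
        using gt_neq_0_imp_nonneg[of N l "\<lambda>i. ?m i - x i" i] ParD(2)[OF l(1)] by force
    qed
  qed (auto simp: compositions_def)
  also have "\<dots> = (\<Sum>k\<in>strips_up N l (int b). gt_number N k ?m)" by (rule pieri_up)
  also have "\<dots> = (\<Sum>k\<in>strips_up N l (int b). schur k m)"
  proof (rule sum.cong[OF refl])
    fix k assume k: "k \<in> strips_up N l (int b)"
    then have "k N = 0" by (simp add: strips_up_def)
    then show "gt_number N k ?m = schur k m" using schur_eq_gt[OF up_Par[OF l(1) k] m] by simp
  qed
  finally show "mtimes (homogeneous b) (schur l) m = (\<Sum>k\<in>strips_up (Suc n) l (int b). schur k m)"
    by (simp only: up_stable[OF l N])
qed

section \<open>The span of the Schur functions and its closure under products\<close>

definition schur_span :: "mseries set" where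
  "schur_span = {f. \<exists>A c. finite A \<and> A \<subseteq> Par \<and> f = (\<lambda>m. \<Sum>l\<in>A. c l * schur l m)}"

lemma schur_span_schur: "l \<in> Par \<Longrightarrow> schur l \<in> schur_span"
  unfolding schur_span_def by (intro CollectI exI[of _ "{l}"] exI[of _ "\<lambda>_. 1"] conjI) simp_all

lemma schur_span_add_mult:
  assumes "f \<in> schur_span" "g \<in> schur_span"
  shows "(\<lambda>m. r * f m + g m) \<in> schur_span"
proof -
  from assms(1) obtain A c where A: "finite A" "A \<subseteq> Par" "f = (\<lambda>m. \<Sum>l\<in>A. c l * schur l m)"
    by (auto simp: schur_span_def)
  from assms(2) obtain B d where B: "finite B" "B \<subseteq> Par" "g = (\<lambda>m. \<Sum>l\<in>B. d l * schur l m)"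
    by (auto simp: schur_span_def)
  define e where "e l = r * (if l \<in> A then c l else 0) + (if l \<in> B then d l else 0)" for l
  have "(\<lambda>m. r * f m + g m) = (\<lambda>m. \<Sum>l\<in>A \<union> B. e l * schur l m)"
  proof
    fix m
    have "f m = (\<Sum>l\<in>A \<union> B. (if l \<in> A then c l else 0) * schur l m)"
      unfolding A(3) using A(1) B(1) by (intro sum.mono_neutral_cong_left) auto
    moreover have "g m = (\<Sum>l\<in>A \<union> B. (if l \<in> B then d l else 0) * schur l m)"
      unfolding B(3) using A(1) B(1) by (intro sum.mono_neutral_cong_left) auto
    ultimately show "r * f m + g m = (\<Sum>l\<in>A \<union> B. e l * schur l m)"
      by (simp add: e_def sum_distrib_left sum.distrib algebra_simps)
  qed
  then show ?thesis unfolding schur_span_def using A B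
    by (intro CollectI exI[of _ "A \<union> B"] exI[of _ e] conjI) simp_all
qed

lemma schur_span_sum:
  assumes "finite I" "\<And>i. i \<in> I \<Longrightarrow> F i \<in> schur_span"
  shows "(\<lambda>m. \<Sum>i\<in>I. c i * F i m) \<in> schur_span"
  using assms
proof (induction I)
  case empty
  show ?case unfolding schur_span_def by (intro CollectI exI[of _ "{}"] conjI) simp_all
next
  case (insert i I)
  then show ?case using schur_span_add_mult[of "F i" "\<lambda>m. \<Sum>i\<in>I. c i * F i m" "c i"] by simp
qed

lemma ex_zero:
  assumes "l \<in> Par"
  shows "\<exists>n. l n = 0"
proof -
  obtain n where "\<forall>i\<in>{i. l i \<noteq> 0}. i < n"
    using ParD(3)[OF assms] by (auto simp: finite_nat_set_iff_bounded)
  then have "l n = 0" by auto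
  then show ?thesis ..
qed

lemma schur_span_homogeneous:
  assumes "f \<in> schur_span"
  shows "mtimes (homogeneous b) f \<in> schur_span"
proof -
  from assms obtain A c where A: "finite A" "A \<subseteq> Par" "f = (\<lambda>m. \<Sum>l\<in>A. c l * schur l m)"
    by (auto simp: schur_span_def)
  have "mtimes (homogeneous b) (schur l) \<in> schur_span" if l: "l \<in> Par" for l
  proof -
    obtain n where "l n = 0" using ex_zero[OF l] by blast
    with schur_span_sum[of "strips_up (Suc n) l (int b)" schur "\<lambda>_. 1"] show ?thesis
      by (simp add: pieri_schur[OF l] finite_up schur_span_schur up_Par[OF l])
  qed
  then have "(\<lambda>m. \<Sum>l\<in>A. c l * mtimes (homogeneous b) (schur l) m) \<in> schur_span"
    using A by (intro schur_span_sum) auto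
  also have "(\<lambda>m. \<Sum>l\<in>A. c l * mtimes (homogeneous b) (schur l) m) = mtimes (homogeneous b) f"
    unfolding A(3) by (simp add: fun_eq_iff mtimes_sum_right)
  finally show ?thesis .
qed

lemma schur_zero: "schur (\<lambda>i. 0) = homogeneous 0"
proof
  fix m :: monom
  have P: "(\<lambda>i. 0) \<in> Par" by (rule ParI) auto
  obtain n where m: "\<forall>k\<ge>n. Poly_Mapping.lookup m k = 0" using ex_bound_keys[of 0 m] by blast
  have monom_of: "monom_of (\<lambda>i. int (Poly_Mapping.lookup m i)) = m" by (simp add: monom_of_def)
  have "homogeneous 0 (monom_of (\<lambda>i. int (Poly_Mapping.lookup m i)))
      = (if (\<Sum>i<n. int (Poly_Mapping.lookup m i)) = int 0 then 1 else 0)"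
    by (rule homogeneous_mon) (use m in auto)
  then have "homogeneous 0 m = (if (\<Sum>i<n. int (Poly_Mapping.lookup m i)) = 0 then 1 else 0)"
    unfolding monom_of by simp
  also have "(\<Sum>i<n. int (Poly_Mapping.lookup m i)) = 0 \<longleftrightarrow> (\<forall>i<n. int (Poly_Mapping.lookup m i) = 0)"
    by (subst sum_nonneg_eq_0_iff) auto
  finally show "schur (\<lambda>i. 0) m = homogeneous 0 m"
    unfolding schur_eq_gt[OF P m] by (simp add: gt_zero)
qed

text \<open>Induction along \<open>s\<^sub>l = h\<^bsub>l 0\<^esub> s\<^sub>d - \<Sum>s\<^sub>k\<close>, where \<open>d\<close> is \<open>l\<close> without its first row and
  all \<open>k\<close> have the size of \<open>l\<close> but a longer first row.\<close>

lemma schur_span_mtimes_schur: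
  assumes "l \<in> Par" "f \<in> schur_span"
  shows "mtimes (schur l) f \<in> schur_span"
  using assms(1)
proof (induction l rule: wf_induct_rule[OF wf_measures[of "[\<lambda>l. card (diagram l), \<lambda>l. card (diagram l) - nat (l 0)]"]])
  case (1 l)
  note l = 1(2)
  obtain n where n: "l n = 0" using ex_zero[OF l] by blast
  define n' where "n' = Suc n"
  have n': "l n' = 0" using ParD(4)[OF l n] by (simp add: n'_def)
  show ?case
  proof (cases "l 0 = 0")
    case True
    then have "l = (\<lambda>i. 0)" using ParD(4)[OF l] by auto
    then show ?thesis using schur_span_homogeneous[OF assms(2), of 0] by (simp add: schur_zero)
  next
    case False
    then have l0: "l 0 > 0" using ParD(2)[OF l, of 0] by simp
    define d where "d i = l (Suc i)" for i
    have dP: "d \<in> Par" by (rule ParI[where n = n]) (use ParD(1)[OF l] ParD(4)[OF l n] in \<open>auto simp: d_def\<close>)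
    have dn: "d n = 0" using ParD(4)[OF l n] by (simp add: d_def)
    have sum_l: "(\<Sum>i<Suc n. l i) = l 0 + (\<Sum>i<n. d i)"
      by (simp add: sum.lessThan_Suc_shift d_def del: sum.lessThan_Suc)
    let ?U = "strips_up (Suc n) d (int (nat (l 0)))"
    have lU: "l \<in> ?U"
      using sum_l l0 dn ParD(1)[OF l] ParD(4)[OF l n] by (auto simp: strips_up_def d_def)
    have "card (diagram d) < card (diagram l)"
      using card_diagram[OF l, of "Suc n"] card_diagram[OF dP dn] sum_l l0 n' by (simp add: n'_def)
    then have span_d: "mtimes (schur d) f \<in> schur_span"
      using 1(1)[of d] dP by simp
    have span_k: "mtimes (schur k) f \<in> schur_span" if k: "k \<in> ?U - {l}" for k
    proof -
      have kP: "k \<in> Par" using k up_Par[OF dP] by blast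
      have k0: "k (Suc n) = 0" using k by (simp add: strips_up_def)
      have sum_k: "(\<Sum>i<Suc n. k i) = (\<Sum>i<Suc n. l i)"
        using k sum_l dn l0 by (auto simp: strips_up_def)
      then have card_k: "card (diagram k) = card (diagram l)"
        using card_diagram[OF l, of "Suc n"] card_diagram[OF kP k0] n' by (simp add: n'_def)
      have le: "k (Suc i) \<le> l (Suc i)" if "i < n" for i using k that by (auto simp: strips_up_def d_def)
      have sums: "k 0 + (\<Sum>i<n. k (Suc i)) = l 0 + (\<Sum>i<n. l (Suc i))"
        using sum_k by (simp add: sum.lessThan_Suc_shift del: sum.lessThan_Suc)
      \<comment> \<open>The lower rows of \<open>k\<close> are at most those of \<open>l\<close> and
        the totals agree, so a first row that is not longer forces \<open>k = l\<close>.\<close>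
      have "k 0 > l 0"
      proof (rule ccontr)
        assume "\<not> k 0 > l 0"
        with sums have "(\<Sum>i<n. l (Suc i) - k (Suc i)) \<le> 0" by (simp add: sum_subtractf)
        then have "l (Suc i) - k (Suc i) \<le> 0" if "i < n" for i
          using le_sum_int[of n "\<lambda>i. l (Suc i) - k (Suc i)" i] le that by fastforce
        then have *: "k (Suc i) = l (Suc i)" if "i < n" for i using le that by (simp add: antisym)
        then have "k 0 = l 0" using sums by simp
        then have "k i = l i" for i
        proof (cases i)
          case (Suc j)
          then show ?thesis using * ParD(4)[OF l n', of i] ParD(4)[OF kP k0, of i] by (cases "j < n") (auto simp: n'_def)
        qed simp
        then show False using k by auto
      qed
      moreover have "k 0 \<le> int (card (diagram k))"
        using card_diagram[OF kP k0] le_sum_int[of "Suc n" k 0] ParD(2)[OF kP] by simp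
      ultimately have "(k, l) \<in> measures [\<lambda>l. card (diagram l), \<lambda>l. card (diagram l) - nat (l 0)]"
        using card_k l0 by simp
      then show ?thesis using 1(1) kP by blast
    qed
    let ?g = "mtimes (homogeneous (nat (l 0))) (mtimes (schur d) f)"
    have fin: "finite ?U" by (rule finite_up)
    have "mtimes (schur l) f = (\<lambda>m. (-1) * (\<Sum>k\<in>?U - {l}. 1 * mtimes (schur k) f m) + ?g m)"
    proof
      fix m
      have "?g m = mtimes (\<lambda>m. \<Sum>k\<in>?U. 1 * schur k m) f m"
        by (simp add: mtimes_assoc[symmetric] pieri_schur[OF dP dn])
      also have "\<dots> = (\<Sum>k\<in>?U. mtimes (schur k) f m)" using mtimes_sum_left[of "\<lambda>_. 1" schur ?U] by simp
      also have "\<dots> = mtimes (schur l) f m + (\<Sum>k\<in>?U - {l}. mtimes (schur k) f m)"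
        by (rule sum.remove[OF fin lU])
      finally show "mtimes (schur l) f m = (-1) * (\<Sum>k\<in>?U - {l}. 1 * mtimes (schur k) f m) + ?g m" by simp
    qed
    also have "\<dots> \<in> schur_span"
      using fin span_k by (intro schur_span_add_mult schur_span_homogeneous schur_span_sum span_d) auto
    finally show ?thesis .
  qed
qed

section \<open>Uniqueness of Schur expansions and Littlewood-Richardson coefficients\<close>

lemma ex_common_zero:
  assumes "finite A" "A \<subseteq> Par"
  shows "\<exists>n. \<forall>l\<in>A. l n = 0"
  using assms
proof (induction A)
  case (insert l A)
  then obtain n k where n: "\<forall>l\<in>A. l n = 0" and k: "l k = 0" using ex_zero[of l] by auto
  then have "\<forall>l'\<in>insert l A. l' (max n k) = 0" using insert ParD(4) by (metis insert_iff insert_subset max.cobounded1 max.cobounded2 subsetD)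
  then show ?case by blast
qed simp

text \<open>Only finitely many shapes occur, so one \<open>n\<close> bounds all their lengths; in
  \<open>n\<close> variables \<open>gt_independent\<close> applies to the difference.\<close>

lemma schur_family_unique:
  assumes c: "finite {l. c l \<noteq> 0}" "{l. c l \<noteq> 0} \<subseteq> Par" and d: "finite {l. d l \<noteq> 0}" "{l. d l \<noteq> 0} \<subseteq> Par"
    and eq: "\<And>m. (\<Sum>l \<in> {l. c l \<noteq> 0}. c l * schur l m) = (\<Sum>l \<in> {l. d l \<noteq> 0}. d l * schur l m)"
  shows "c = d"
proof -
  let ?A = "{l. c l \<noteq> 0} \<union> {l. d l \<noteq> 0}"
  have A: "finite ?A" "?A \<subseteq> Par" using c d by auto
  obtain n where n: "\<forall>l\<in>?A. l n = 0" using ex_common_zero[OF A] by blast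
  have "\<forall>l\<in>?A. c l - d l = 0"
  proof (rule gt_independent[OF A(1)])
    show "(\<forall>i. Suc i < n \<longrightarrow> l (Suc i) \<le> l i) \<and> (\<forall>i\<ge>n. l i = 0)" if "l \<in> ?A" for l
    proof -
      have "l \<in> Par" "l n = 0" using that A(2) n by blast+
      then show ?thesis using ParD(1)[of l] ParD(4)[of l n] by simp
    qed
    fix m assume m: "m \<in> ?A"
    then have mP: "m \<in> Par" "m n = 0" using A(2) n by blast+
    have "schur l (monom_of m) = gt_number n l m" if "l \<in> ?A" for l
    proof (rule schur_mon)
      show "l \<in> Par" "l n = 0" using that A(2) n by blast+
    qed (use ParD(2)[OF mP(1)] ParD(4)[OF mP] in auto)
    then have "(\<Sum>l\<in>?A. (c l - d l) * gt_number n l m) = (\<Sum>l\<in>?A. c l * schur l (monom_of m)) - (\<Sum>l\<in>?A. d l * schur l (monom_of m))"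
      by (simp add: sum_subtractf left_diff_distrib)
    also have "(\<Sum>l\<in>?A. c l * schur l (monom_of m)) = (\<Sum>l\<in>{l. c l \<noteq> 0}. c l * schur l (monom_of m))"
      using A by (intro sum.mono_neutral_right) auto
    also have "(\<Sum>l\<in>?A. d l * schur l (monom_of m)) = (\<Sum>l\<in>{l. d l \<noteq> 0}. d l * schur l (monom_of m))"
      using A by (intro sum.mono_neutral_right) auto
    finally show "(\<Sum>l\<in>?A. (c l - d l) * gt_number n l m) = 0" by (simp add: eq)
  qed
  then have in_A: "c l = d l" if "l \<in> ?A" for l
    by (subst eq_iff_diff_eq_0, rule bspec) (rule that)
  show ?thesis
  proof
    show "c l = d l" for l by (cases "l \<in> ?A", rule in_A) simp_all
  qed
qed

text \<open>Discharges the definite description in \<open>lr\<close>: closure of the span under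
  products gives existence, \<open>schur_family_unique\<close> gives uniqueness.\<close>

lemma lr_expansion:
  assumes "mu \<in> Par" "nu \<in> Par"
  shows "finite {l. lr mu nu l \<noteq> 0}" "{l. lr mu nu l \<noteq> 0} \<subseteq> Par"
    "mtimes (schur mu) (schur nu) m = (\<Sum>l \<in> {l. lr mu nu l \<noteq> 0}. lr mu nu l * schur l m)"
proof -
  let ?P = "\<lambda>c. finite {l. c l \<noteq> 0} \<and> {l. c l \<noteq> 0} \<subseteq> Par \<and>
     mtimes (schur mu) (schur nu) = (\<lambda>m. \<Sum>l \<in> {l. c l \<noteq> 0}. c l * schur l m)"
  have "mtimes (schur mu) (schur nu) \<in> schur_span"
    by (intro schur_span_mtimes_schur schur_span_schur assms)
  then obtain A c where A: "finite A" "A \<subseteq> Par" "mtimes (schur mu) (schur nu) = (\<lambda>m. \<Sum>l\<in>A. c l * schur l m)"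
    by (auto simp: schur_span_def)
  define d where "d l = (if l \<in> A then c l else 0)" for l
  have sub: "{l. d l \<noteq> 0} \<subseteq> A" by (auto simp: d_def)
  have "mtimes (schur mu) (schur nu) = (\<lambda>m. \<Sum>l \<in> {l. d l \<noteq> 0}. d l * schur l m)"
    unfolding A(3) using sub A(1) by (intro ext sum.mono_neutral_cong_right) (auto simp: d_def)
  then have Pd: "?P d" using sub A finite_subset by blast
  have "?P (lr mu nu)" unfolding lr_def
  proof (rule theI[of ?P d])
    show "?P d" by (rule Pd)
    fix c assume Pc: "?P c"
    show "c = d" using Pc Pd by (intro schur_family_unique) (auto simp: fun_eq_iff)
  qed
  then show "finite {l. lr mu nu l \<noteq> 0}" "{l. lr mu nu l \<noteq> 0} \<subseteq> Par"
    "mtimes (schur mu) (schur nu) m = (\<Sum>l \<in> {l. lr mu nu l \<noteq> 0}. lr mu nu l * schur l m)"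
    by (auto simp: fun_eq_iff)
qed

text \<open>The full expansion may contain shapes with more than \<open>n\<close> rows. They vanish
  on monomials in \<open>n\<close> variables, so a comparison there determines the coefficients of
  all shapes with at most \<open>n\<close> rows.\<close>

lemma lr_eqI:
  assumes mu: "mu \<in> Par" and nu: "nu \<in> Par" and S: "finite S" "\<And>l. l \<in> S \<Longrightarrow> l \<in> Par \<and> l n = 0"
    and eq: "\<And>x. (\<And>i. i < n \<Longrightarrow> 0 \<le> x i) \<Longrightarrow> \<forall>i\<ge>n. x i = 0 \<Longrightarrow>
       mtimes (schur mu) (schur nu) (monom_of x) = (\<Sum>l\<in>S. d l * gt_number n l x)"
    and l: "l \<in> Par" "l n = 0"
  shows "lr mu nu l = (if l \<in> S then d l else 0)"
proof -
  let ?c = "lr mu nu" and ?d = "\<lambda>l. if l \<in> S then d l else 0"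
  note c = lr_expansion[OF mu nu]
  \<comment> \<open>\<open>l\<close> is inserted so that the comparison also covers a shape outside
    both supports.\<close>
  let ?A = "insert l ({l. ?c l \<noteq> 0 \<and> l n = 0} \<union> S)"
  have "finite {l. ?c l \<noteq> 0 \<and> l n = 0}" by (rule finite_subset[OF _ c(1)]) blast
  then have A: "finite ?A" using S(1) by simp
  have AP: "l' \<in> Par \<and> l' n = 0" if l': "l' \<in> ?A" for l'
  proof -
    consider "l' = l" | "?c l' \<noteq> 0 \<and> l' n = 0" | "l' \<in> S" using l' by blast
    then show ?thesis by cases (use l S(2) c(2) in blast)+
  qed
  have "\<forall>l\<in>?A. ?c l - ?d l = 0"
  proof (rule gt_independent[OF A])
    show "(\<forall>i. Suc i < n \<longrightarrow> l' (Suc i) \<le> l' i) \<and> (\<forall>i\<ge>n. l' i = 0)" if l': "l' \<in> ?A" for l'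
    proof -
      have "l' \<in> Par" "l' n = 0" using AP[OF l'] by blast+
      then show ?thesis using ParD(1)[of l'] ParD(4)[of l' n] by simp
    qed
    fix m assume "m \<in> ?A"
    then have m: "m \<in> Par" "m n = 0" using AP by blast+
    have m0: "\<And>i. 0 \<le> m i" "\<forall>i\<ge>n. m i = 0" using ParD(2)[OF m(1)] ParD(4)[OF m] by auto
    have schur: "schur l (monom_of m) = (if l n = 0 then gt_number n l m else 0)" if "l \<in> Par" for l
    proof -
      have "\<forall>k\<ge>n. Poly_Mapping.lookup (monom_of m) k = 0" using lookup_mon[OF m0(2)] m0 by simp
      then have "l n \<noteq> 0 \<Longrightarrow> schur l (monom_of m) = 0" using schur_eq_gt[OF that] by simp
      then show ?thesis using schur_mon[OF that _ m0(2)] m0(1) by auto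
    qed
    have "(\<Sum>l\<in>?A. ?c l * gt_number n l m) = (\<Sum>l\<in>{l. ?c l \<noteq> 0 \<and> l n = 0}. ?c l * gt_number n l m)"
      using A l(2) by (intro sum.mono_neutral_right) (auto dest: S(2))
    also have "\<dots> = (\<Sum>l\<in>{l. ?c l \<noteq> 0}. ?c l * schur l (monom_of m))"
    proof (intro sum.mono_neutral_cong_left c(1))
      have "schur l (monom_of m) = (if l n = 0 then gt_number n l m else 0)" if "?c l \<noteq> 0" for l
        using schur c(2) that by blast
      then show "\<forall>l\<in>{l. ?c l \<noteq> 0} - {l. ?c l \<noteq> 0 \<and> l n = 0}. ?c l * schur l (monom_of m) = 0"
        "\<And>l. l \<in> {l. ?c l \<noteq> 0 \<and> l n = 0} \<Longrightarrow> ?c l * gt_number n l m = ?c l * schur l (monom_of m)"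
        by auto
    qed auto
    also have "\<dots> = (\<Sum>l\<in>S. d l * gt_number n l m)"
      unfolding c(3)[symmetric] using m0 by (intro eq) auto
    also have "\<dots> = (\<Sum>l\<in>?A. ?d l * gt_number n l m)"
      using A by (intro sum.mono_neutral_cong_left) auto
    finally show "(\<Sum>l\<in>?A. (?c l - ?d l) * gt_number n l m) = 0"
      by (simp only: left_diff_distrib sum_subtractf)
  qed
  then have "?c l - ?d l = 0" by (rule bspec) simp
  then show ?thesis by (simp only: right_minus_eq)
qed

section \<open>The hidden symmetry\<close>

lemma nth_pad: "pad w i = (if i < length w then w ! i else 0)"
  by (simp add: pad_def)

text \<open>Dividing by the a-th power of the product of the variables turns \<open>al\<close> into
  (b, 0, ..., 0, -a), to which \<open>hook_convolution\<close> applies; grouping the surviving pairs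
  by \<open>v\<close> yields the counts.\<close>

lemma schur_product_eq:
  fixes a b :: nat
  assumes n: "2 \<le> n" and mu: "mu \<in> Par" "mu n = 0"
    and x: "\<And>i. i < n \<Longrightarrow> 0 \<le> x i" "\<forall>i\<ge>n. x i = 0"
    and al: "al \<in> Par" "al = (\<lambda>i. if i < n then (if i = 0 then int b else if i = n - 1 then - int a else 0) + int a else 0)"
    and V: "V = {v. connecting n mu v (int b) (int a) \<noteq> {}}"
  shows "mtimes (schur al) (schur mu) (monom_of x)
    = (\<Sum>v\<in>V. int (card (connecting n mu v (int b) (int a))) * gt_number n v (\<lambda>i. x i - int a))"
proof -
  let ?h = "\<lambda>i::nat. if i = 0 then int b else if i = n - 1 then - int a else 0"
  let ?Y = "{y. (\<forall>i<n. 0 \<le> y i \<and> y i \<le> x i) \<and> (\<forall>i\<ge>n. y i = 0)}"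
  let ?m = "\<lambda>i. x i - int a"
  let ?Z = "{z. (\<forall>i<n. - int a \<le> z i \<and> z i \<le> ?m i) \<and> (\<forall>i\<ge>n. z i = 0)}"
  have al_n: "al n = 0" using al by simp
  have lookup: "int (Poly_Mapping.lookup (monom_of x) i) = x i" for i
    using x by (cases "i < n") (simp_all add: lookup_mon[OF x(2)])
  have keys: "\<forall>k\<ge>n. Poly_Mapping.lookup (monom_of x) k = 0" using x(2) by (simp add: lookup_mon[OF x(2)])
  have "mtimes (schur al) (schur mu) (monom_of x) = (\<Sum>y\<in>?Y. schur al (monom_of y) * schur mu (monom_of (\<lambda>i. x i - y i)))"
    unfolding mtimes_box[OF keys] lookup ..
  also have "\<dots> = (\<Sum>y\<in>?Y. gt_number n al y * gt_number n mu (\<lambda>i. x i - y i))"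
    using x(2) al mu al_n by (intro sum.cong refl arg_cong2[where f = "(*)"] schur_mon) auto
  also have "\<dots> = (\<Sum>z\<in>?Z. gt_number n ?h z * gt_number n mu (\<lambda>i. ?m i - z i))"
  proof (rule sum.reindex_bij_witness[where j = "\<lambda>y i. if i < n then y i - int a else 0"
        and i = "\<lambda>z i. if i < n then z i + int a else 0"])
    fix y assume y: "y \<in> ?Y"
    have "gt_number n mu (\<lambda>i. ?m i - (if i < n then y i - int a else 0)) = gt_number n mu (\<lambda>i. x i - y i)"
      by (rule gt_cong) simp
    moreover have "gt_number n ?h (\<lambda>i. if i < n then y i - int a else 0) = gt_number n al y"
    proof -
      have "gt_number n al (\<lambda>i. (if i < n then y i - int a else 0) + int a) = gt_number n al y"
        by (rule gt_cong) simp
      then show ?thesis unfolding al(2) gt_shift .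
    qed
    ultimately show "gt_number n ?h (\<lambda>i. if i < n then y i - int a else 0) * gt_number n mu (\<lambda>i. ?m i - (if i < n then y i - int a else 0))
      = gt_number n al y * gt_number n mu (\<lambda>i. x i - y i)" by simp
  qed auto
  also have "\<dots> = add_remove n (int b) (int a) (gt_number n mu) ?m - add_remove n (int b - 1) (int a - 1) (gt_number n mu) ?m"
    by (rule hook_convolution[OF n _ refl]) (use ParD(2)[OF mu(1)] in simp)
  also have "\<dots> = (\<Sum>(k, v)\<in>{(k, v). k \<in> strips_up n mu (int b) \<and> v \<in> strips_down n k (int a) \<and> k 0 = max (mu 0) (v 0)}. gt_number n v ?m)"
    using n by (intro add_remove_diff) simp
  also have "\<dots> = (\<Sum>v\<in>V. int (card (connecting n mu v (int b) (int a))) * gt_number n v ?m)"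
    unfolding V by (rule sum_connecting[OF finite_connected]) simp
  finally show ?thesis .
qed

lemma lr_coeff_eq_card:
  fixes a b :: nat
  assumes n: "2 \<le> n" and mu: "mu \<in> Par" "mu n = 0" and w: "length w = n"
  shows "lr_coeff (pad (int (a + b) # replicate (n - 2) (int a))) mu w
    = int (card (connecting n mu (\<lambda>i. if i < n then w ! i - int a else 0) (int b) (int a)))"
proof -
  let ?al = "pad (int (a + b) # replicate (n - 2) (int a))"
  let ?shift = "\<lambda>v i. if i < n then v i + int a else 0"
  let ?unshift = "\<lambda>l i. if i < n then l i - int a else 0"
  let ?card = "\<lambda>v. int (card (connecting n mu v (int b) (int a)))"
  define V where "V = {v. connecting n mu v (int b) (int a) \<noteq> {}}"
  have n0: "0 < n" using n by simp
  \<comment> \<open>As an \<open>n\<close>-tuple \<alpha> ends in a single 0, so it is the row (b,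
    0, ..., 0, -a) raised by \<open>a\<close>.\<close>
  have al: "?al = (\<lambda>i. if i < n then (if i = 0 then int b else if i = n - 1 then - int a else 0) + int a else 0)"
    using n by (auto simp: fun_eq_iff nth_pad nth_Cons split: nat.split)
  have alP: "?al \<in> Par"
    unfolding al by (rule ParI[where n = n]) (use n in auto)
  have V0: "\<forall>i\<ge>n. v i = 0" if "v \<in> V" for v
    using that by (auto simp: V_def connecting_def strips_down_def)
  have us: "?unshift (?shift v) = v" if "\<forall>i\<ge>n. v i = 0" for v
    using that by (auto simp: fun_eq_iff)
  have VP: "?shift v \<in> Par" if v: "v \<in> V" for v
  proof (rule ParI[where n = n])
    obtain k where k: "k \<in> connecting n mu v (int b) (int a)" using v by (auto simp: V_def)
    have nn: "\<And>i. i < n \<Longrightarrow> 0 \<le> mu i" using ParD(2)[OF mu(1)] by simp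
    note ne = connecting_nonempty[OF k n0 V0[OF v] nn]
    fix i
    consider "Suc i < n" | "i = n - 1" | "n \<le> i" by linarith
    then show "?shift v (Suc i) \<le> ?shift v i"
      by cases (use ne(1)[of i] ne(2) n in auto)
  qed simp
  have "lr_coeff ?al mu w = (if pad w \<in> Par then lr ?al mu (pad w) else 0)"
    by (simp add: lr_coeff_def)
  also have "\<dots> = ?card (?unshift (pad w))"
  proof (cases "pad w \<in> Par")
    case True
    have pw: "?shift (?unshift (pad w)) = pad w" using w by (auto simp: fun_eq_iff nth_pad)
    have "lr ?al mu (pad w) = (if pad w \<in> ?shift ` V then ?card (?unshift (pad w)) else 0)"
    proof (rule lr_eqI[OF alP mu(1), where n = n])
      show "finite (?shift ` V)" unfolding V_def by (intro finite_imageI finite_connected)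
      show "l \<in> Par \<and> l n = 0" if "l \<in> ?shift ` V" for l using that VP by auto
      fix x :: "nat \<Rightarrow> int"
      assume x: "\<And>i. i < n \<Longrightarrow> 0 \<le> x i" "\<forall>i\<ge>n. x i = 0"
      have "inj_on ?shift V"
        by (rule inj_on_inverseI[where g = ?unshift]) (use V0 us in blast)
      then have "(\<Sum>l\<in>?shift ` V. ?card (?unshift l) * gt_number n l x) = (\<Sum>v\<in>V. ?card (?unshift (?shift v)) * gt_number n (?shift v) x)"
        by (simp only: sum.reindex o_def)
      also have "\<dots> = (\<Sum>v\<in>V. ?card v * gt_number n v (\<lambda>i. x i - int a))"
      proof (rule sum.cong[OF refl])
        fix v assume v: "v \<in> V"
        have "gt_number n (?shift v) x = gt_number n (?shift v) (\<lambda>i. (x i - int a) + int a)" by simp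
        also have "\<dots> = gt_number n v (\<lambda>i. x i - int a)" by (rule gt_shift)
        finally show "?card (?unshift (?shift v)) * gt_number n (?shift v) x = ?card v * gt_number n v (\<lambda>i. x i - int a)"
          unfolding us[OF V0[OF v]] by (simp only:)
      qed
      finally show "mtimes (schur ?al) (schur mu) (monom_of x) = (\<Sum>l\<in>?shift ` V. ?card (?unshift l) * gt_number n l x)"
        by (intro trans[OF schur_product_eq[OF n mu x alP al V_def] sym])
    qed (use True w in \<open>simp_all add: nth_pad[of _ n]\<close>)
    moreover have "?card (?unshift (pad w)) = 0" if "pad w \<notin> ?shift ` V"
    proof -
      have "?unshift (pad w) \<notin> V"
        using that imageI[of "?unshift (pad w)" V ?shift] unfolding pw by blast
      then have "connecting n mu (?unshift (pad w)) (int b) (int a) = {}" unfolding V_def by blast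
      then show ?thesis by simp
    qed
    ultimately have "lr ?al mu (pad w) = ?card (?unshift (pad w))"
      by (cases "pad w \<in> ?shift ` V") (simp_all only: if_True if_False simp_thms)
    then show ?thesis using True by (simp only: if_True)
  next
    case False
    \<comment> \<open>A tuple with a connecting point is a partition by \<open>VP\<close>, so here
      the count is 0, in agreement with the convention for the coefficient.\<close>
    have "?shift (?unshift (pad w)) = pad w" using w by (auto simp: fun_eq_iff nth_pad)
    then have "?unshift (pad w) \<notin> V" using VP[of "?unshift (pad w)"] False by argo
    then have "connecting n mu (?unshift (pad w)) (int b) (int a) = {}" unfolding V_def by blast
    then show ?thesis using False by simp
  qed
  also have "?unshift (pad w) = (\<lambda>i. if i < n then w ! i - int a else 0)"
    using w by (auto simp: fun_eq_iff nth_pad)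
  finally show ?thesis .
qed

section \<open>From tuples with cyclic indices to periodic functions\<close>

definition cyc :: "nat \<Rightarrow> int list \<Rightarrow> int \<Rightarrow> int" where
  "cyc n w i = w ! nat ((i - 1) mod int n)"

lemma cyc_periodic: "cyc n w (i + int n) = cyc n w i"
proof -
  have "(i - 1 + int n) mod int n = (i - 1) mod int n" by (rule mod_add_self2)
  then have "(i + int n - 1) mod int n = (i - 1) mod int n" by (simp only: add_diff_eq diff_add_eq)
  then show ?thesis by (simp add: cyc_def)
qed

lemma cyc_nth: "j < n \<Longrightarrow> cyc n w (int j + 1) = w ! j"
  by (simp add: cyc_def)

lemma entry_hash: "0 < n \<Longrightarrow> entry w (hash n i) = cyc n w i"
  by (simp add: entry_def hash_eq cyc_def)

lemma cyc_hash: "0 < n \<Longrightarrow> cyc n w (hash n i + j) = cyc n w (i + j)"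
  by (simp add: hash_eq cyc_def algebra_simps mod_simps)

lemma tau_eq:
  assumes n: "0 < n"
  shows "tau n M w (hash n j) = cyc_tau n (cyc n M) (cyc n w) j"
proof -
  have 1: "(\<Sum>i = 1..int k. f (j + i)) = (\<Sum>i<k. f (j + 1 + int i))" for k and f :: "int \<Rightarrow> int"
    by (rule sum.reindex_bij_witness[where i = "\<lambda>i. int i + 1" and j = "\<lambda>i. nat (i - 1)"]) auto
  have 2: "(\<Sum>i = int k + 1..int n - 1. f (j + i)) = (\<Sum>i\<in>{k..<n-1}. f (j + 1 + int i))" for k and f :: "int \<Rightarrow> int"
    by (rule sum.reindex_bij_witness[where i = "\<lambda>i. int i + 1" and j = "\<lambda>i. nat (i - 1)"]) auto
  have I: "{0..int n - 1} = int ` {..<n}"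
  proof (intro equalityI subsetI)
    fix k assume "k \<in> {0..int n - 1}"
    then show "k \<in> int ` {..<n}" by (intro image_eqI[where x = "nat k"]) auto
  qed auto
  show ?thesis
    unfolding tau_def cyc_tau_def I image_image entry_hash[OF n] cyc_hash[OF n] 1 2 ..
qed

lemma phi_eq:
  assumes n: "0 < n"
  shows "phi n a b M w = map (\<lambda>i. cyc_eta n (cyc n M) (cyc n (map (\<lambda>x. x - int a) w)) i + int b) [1..int n]"
  by (simp add: phi_def Let_def eta_def cyc_eta_def entry_hash[OF n] tau_eq[OF n])

lemma cyc_map_upto:
  assumes n: "0 < n" and per: "\<And>i. f (i + int n) = f i"
  shows "cyc n (map f [1..int n]) i = f i"
proof -
  have per': "f (i + int n * k) = f i" for i k
  proof (induction k rule: int_induct[where k = 0])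
    case (step1 k)
    then show ?case using per[of "i + int n * k"] by (simp add: algebra_simps)
  next
    case (step2 k)
    then show ?case using per[of "i + int n * (k - 1)"] by (simp add: algebra_simps)
  qed simp
  define r where "r = (i - 1) mod int n"
  have r: "0 \<le> r" "r < int n" using n by (simp_all add: r_def)
  have "cyc n (map f [1..int n]) i = f (1 + r)"
    using r by (simp add: cyc_def r_def[symmetric] nth_map nth_upto)
  also have "\<dots> = f (1 + r + int n * ((i - 1) div int n))" by (rule per'[symmetric])
  also have "1 + r + int n * ((i - 1) div int n) = i"
    by (simp add: r_def)
  finally show ?thesis .
qed

lemma cyclic_pair_cyc: "2 \<le> n \<Longrightarrow> cyclic_pair n (cyc n v) (cyc n w)"
  by unfold_locales (simp_all add: cyc_periodic)

lemma length_phi: "length (phi n a b M w) = n"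
  by (simp add: phi_def Let_def)

lemma cyc_phi:
  assumes n: "2 \<le> n"
  shows "cyc n (map (\<lambda>x. x - int b) (phi n a b M w)) = cyc_eta n (cyc n M) (cyc n (map (\<lambda>x. x - int a) w))"
proof
  fix i
  interpret cyclic_pair n "cyc n M" "cyc n (map (\<lambda>x. x - int a) w)" by (rule cyclic_pair_cyc[OF n])
  have "map (\<lambda>x. x - int b) (phi n a b M w) = map y [1..int n]"
    using n by (simp add: phi_eq o_def)
  then show "cyc n (map (\<lambda>x. x - int b) (phi n a b M w)) i = y i"
    using n by (simp add: cyc_map_upto y_per)
qed

text \<open>The same involution acts in both directions; only the shift subtracted on entry and the
  one added on exit trade places.\<close>

lemma phi_phi:
  assumes n: "2 \<le> n" and w: "length w = n"
  shows "phi n b a M (phi n a b M w) = w"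
proof -
  interpret cyclic_pair n "cyc n M" "cyc n (map (\<lambda>x. x - int a) w)" by (rule cyclic_pair_cyc[OF n])
  have "phi n b a M (phi n a b M w) = map (\<lambda>i. cyc n (map (\<lambda>x. x - int a) w) i + int a) [1..int n]"
    using n by (simp add: phi_eq[of n b a] cyc_phi involution)
  also have "\<dots> = w"
  proof (rule nth_equalityI)
    fix j assume "j < length (map (\<lambda>i. cyc n (map (\<lambda>x. x - int a) w) i + int a) [1..int n])"
    then have j: "j < n" by simp
    then have "cyc n (map (\<lambda>x. x - int a) w) (1 + int j) = w ! j - int a"
      using cyc_nth[OF j] w by (simp add: add.commute)
    then show "map (\<lambda>i. cyc n (map (\<lambda>x. x - int a) w) i + int a) [1..int n] ! j = w ! j"
      using j by (simp add: nth_upto)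
  qed (simp add: w)
  finally show ?thesis .
qed

lemma Par_upto_zero:
  assumes "mu \<in> Par_upto n"
  shows "mu \<in> Par" "mu n = 0"
proof -
  show mu: "mu \<in> Par" using assms by (simp add: Par_upto_def)
  show "mu n = 0"
  proof (rule ccontr)
    assume "mu n \<noteq> 0"
    then have "{..n} \<subseteq> {i. mu i \<noteq> 0}" using ParD(4)[OF mu] by auto
    then have "card {..n} \<le> card {i. mu i \<noteq> 0}" using ParD(3)[OF mu] by (intro card_mono)
    then show False using assms by (simp add: Par_upto_def)
  qed
qed

theorem theorem2p3:
  fixes n a b :: nat and mu :: "nat \<Rightarrow> int"
  assumes "n \<ge> 2" and "mu \<in> Par_upto n"
  shows "bij_betw (phi n a b (truncate n mu)) (tuples n) (tuples n) \<and>
    (\<forall>w \<in> tuples n.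
       lr_coeff (pad (int (a + b) # replicate (n - 2) (int a))) mu w
       = lr_coeff (pad (int (a + b) # replicate (n - 2) (int b))) mu
           (phi n a b (truncate n mu) w))"
proof (intro conjI ballI)
  note n = assms(1) and mu = Par_upto_zero[OF assms(2)]
  let ?M = "truncate n mu"
  show "bij_betw (phi n a b ?M) (tuples n) (tuples n)"
    by (rule bij_betw_byWitness[where f' = "phi n b a ?M"])
      (use n in \<open>auto simp: tuples_def phi_phi length_phi\<close>)
  fix w assume "w \<in> tuples n"
  then have w: "length w = n" by (simp add: tuples_def)
  let ?v = "map (\<lambda>x. x - int a) w"
  interpret cyclic_pair n "cyc n ?M" "cyc n ?v" by (rule cyclic_pair_cyc[OF n])
  define v where "v i = (if i < n then w ! i - int a else 0)" for i
  \<comment> \<open>Undoing the final shift by \<open>b\<close> recovers \<eta>.\<close>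
  define z where "z i = (if i < n then phi n a b ?M w ! i - int b else 0)" for i
  have u_nth: "cyc n ?M (int i + 1) = mu i" if "i < n" for i
    using that by (simp add: cyc_nth truncate_def)
  have x_nth: "cyc n ?v (int i + 1) = v i" if "i < n" for i
    using that w by (simp add: cyc_nth v_def)
  have y_nth: "y (int i + 1) = z i" if "i < n" for i
    using that n by (simp add: z_def phi_eq nth_upto add.commute)
  \<comment> \<open>List positions start at 0 and cyclic indices at 1; over a full period this
    offset does not change a sum.\<close>
  have sums: "(\<Sum>i<n. f (int i)) = (\<Sum>i<n. g i)" if "\<And>i. f (i + int n) = f i" "\<And>i. i < n \<Longrightarrow> f (int i + 1) = g i"
    for f :: "int \<Rightarrow> int" and g
    using sum_shift1[of f 1] that by simp
  have "card (connecting n mu v (int b) (int a)) = card (connecting n mu z (int a) (int b))"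
  proof (rule card_connecting_eq)
    show "0 < n" using n by simp
    show "min (mu i) (z i) - max (mu (Suc i)) (z (Suc i)) = min (mu i) (v i) - max (mu (Suc i)) (v (Suc i))" if "Suc i < n" for i
      using interval_length[of "int i + 1"] u_nth[of i] u_nth[of "Suc i"] x_nth[of i] x_nth[of "Suc i"] y_nth[of i] y_nth[of "Suc i"] that
      by (simp add: add.commute add.left_commute)
    show "(\<Sum>i<n. z i) = 2 * (\<Sum>i<n. mu i) - (\<Sum>i<n. v i)"
      using sum_y sums[of y z] sums[of "cyc n ?M" mu] sums[of "cyc n ?v" v] y_per u_per x_per u_nth x_nth y_nth by simp
    show "(\<Sum>i<n. min (mu i) (z i)) = (\<Sum>i<n. mu i) - (\<Sum>i<n. v i) + (\<Sum>i<n. min (mu i) (v i))"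
      using sum_min_y sums[of "\<lambda>i. min (cyc n ?M i) (y i)" "\<lambda>i. min (mu i) (z i)"]
        sums[of "\<lambda>i. min (cyc n ?M i) (cyc n ?v i)" "\<lambda>i. min (mu i) (v i)"]
        sums[of "cyc n ?M" mu] sums[of "cyc n ?v" v] y_per u_per x_per u_nth x_nth y_nth by simp
  qed (simp_all add: v_def z_def)
  \<comment> \<open>Exchanging \<open>a\<close> and \<open>b\<close> turns \<alpha> into \<beta>, so
    the same counting formula applies to the image tuple, with \<open>b\<close> as the
    shift.\<close>
  then show "lr_coeff (pad (int (a + b) # replicate (n - 2) (int a))) mu w
      = lr_coeff (pad (int (a + b) # replicate (n - 2) (int b))) mu (phi n a b ?M w)"
    using lr_coeff_eq_card[OF n mu w, of a b] lr_coeff_eq_card[OF n mu length_phi, of b a a b ?M w]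
    by (simp add: v_def[abs_def] z_def[abs_def] add.commute)
qed

end
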